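(* Let $T>0$, $q\in(1,\infty)$, $n\ge2$. With the sets $\mathcal F\subset\mathbb R^n\times L^q(0,T)^{n-1}$ and $\mathcal F^{\mathrm{ext}}\subset\mathbb R^n\times L^q(0,T)^{n-1}\times L^q(0,T)^n$ defined in the context, there holds $$\pi_{(\tau,\chi)}(\mathcal F^{\mathrm{ext}})=\overline{\operatorname{conv}(\mathcal F)}^{\,\mathbb R^n\times L^q(0,T)^{n-1}},$$ where $\pi_{(\tau,\chi)}(\mathcal F^{\mathrm{ext}}):=\{(\tau,\chi)\in\mathbb R^n\times L^q(0,T)^{n-1}:\ \exists\,z\in L^q(0,T)^n\text{ with }(\tau,\chi,z)\in\mathcal F^{\mathrm{ext}}\}$.
   Context: $\mathcal P:=\{\tau\in\mathbb R^n:0\le\tau_1\le\tau_2\le\dots\le\tau_n\le T\}$. The set of feasible switching functions is $$\mathcal F:=\{(\tau,\chi)\in\mathbb R^n\times L^q(0,T)^{n-1}:\ \tau\in\mathcal P,\ \chi_i=\chi_{[\tau_i,\tau_{i+1})},\ i=1,\dots,n-1\},$$ where $\chi_{[a,b)}$ is the characteristic function of $[a,b)$. $\mathrm{BV}(0,T)$ is the space of $v\in L^1(0,T)$ whose distributional derivative $Dv$ is a regular Borel measure on $(0,T)$; $\mathrm{BV}(0,T;[0,1])$ are those with values in $[0,1]$ a.e. $\mathcal F^{\mathrm{ext}}$ is the set of all $(\tau,\chi,z)\in\mathbb R^n\times L^q(0,T)^{n-1}\times L^q(0,T)^n$ such that: $\chi_i,z_j\in\mathrm{BV}(0,T;[0,1])$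 for $i=1,\dots,n-1$, $j=1,\dots,n$; $\chi_i=z_i-z_{i+1}$ a.e. in $(0,T)$ for $i=1,\dots,n-1$; $z_i\le z_{i-1}$ a.e. in $(0,T)$ for $i=2,\dots,n$; $Dz_i\ge0$ (i.e. $Dz_i$ is a non-negative measure) for $i=1,\dots,n$; and $\tau_i=\int_0^T(1-z_i(t))\,dt$ for $i=1,\dots,n$. $\operatorname{conv}$ is the convex hull and the bar denotes closure in the indicated norm topology. *)

theory Defs
  imports "HOL-Analysis.Analysis" "HOL-Library.Function_Algebras"
begin

text \<open>Functions into a real vector space form a real vector space under the pointwise operations;
  this makes \<^const>\<open>convex\<close> and \<^const>\<open>hull\<close> applicable to tuples of functions.\<close>

instantiation "fun" :: (type, scaleR) scaleR
begin

definition scaleR_fun :: "real \<Rightarrow> ('a \<Rightarrow> 'b) \<Rightarrow> 'a \<Rightarrow> 'b"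
  where "scaleR_fun c f = (\<lambda>x. c *\<^sub>R f x)"

instance ..

end

instance "fun" :: (type, real_vector) real_vector
  by standard (simp_all add: scaleR_fun_def fun_eq_iff scaleR_add_right scaleR_add_left)

text \<open>Elements of \<open>L\<^sup>q(0,T)\<close> are represented by functions \<open>real \<Rightarrow> real\<close>, of which only the values on
  \<open>(0,T)\<close>, up to null sets, matter. There is no passage to equivalence classes; instead every set
  of tuples of functions below is closed under changing the components on null sets.

  Vectors \<open>(x\<^sub>1,\<dots>,x\<^sub>m)\<close> are functions on \<open>nat\<close> that vanish at the indices outside \<open>{1..m}\<close>.\<close>

abbreviation leb :: "real \<Rightarrow> real measure"
  where "leb T \<equiv> lebesgue_on {0<..<T}"

definition Lq :: "real \<Rightarrow> real \<Rightarrow> (real \<Rightarrow> real) set"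
  where "Lq T q = {f \<in> borel_measurable (leb T).
           integrable (leb T) (\<lambda>t. \<bar>f t\<bar> powr q)}"

definition Lq_norm :: "real \<Rightarrow> real \<Rightarrow> (real \<Rightarrow> real) \<Rightarrow> real"
  where "Lq_norm T q f = (LINT t|leb T. \<bar>f t\<bar> powr q) powr (1 / q)"

definition Rvec :: "nat \<Rightarrow> (nat \<Rightarrow> real) set"
  where "Rvec n = {x. \<forall>i. i \<notin> {1..n} \<longrightarrow> x i = 0}"

definition Lq_vec :: "real \<Rightarrow> real \<Rightarrow> nat \<Rightarrow> (nat \<Rightarrow> real \<Rightarrow> real) set"
  where "Lq_vec T q m = {f. (\<forall>i\<in>{1..m}. f i \<in> Lq T q) \<and> (\<forall>i. i \<notin> {1..m} \<longrightarrow> f i = (\<lambda>t. 0))}"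

text \<open>The norm of \<open>\<real>\<^sup>n \<times> L\<^sup>q(0,T)\<^bsup>n-1\<^esup>\<close> (any other product norm is equivalent) and its topology: a set is
  open if it contains a ball around each of its points. On representatives the norm is a seminorm,
  so this is the pullback of the norm topology under passage to equivalence classes.\<close>

definition RL_space :: "real \<Rightarrow> real \<Rightarrow> nat \<Rightarrow> ((nat \<Rightarrow> real) \<times> (nat \<Rightarrow> real \<Rightarrow> real)) set"
  where "RL_space T q n = Rvec n \<times> Lq_vec T q (n - 1)"

definition RL_norm :: "real \<Rightarrow> real \<Rightarrow> nat \<Rightarrow> (nat \<Rightarrow> real) \<times> (nat \<Rightarrow> real \<Rightarrow> real) \<Rightarrow> real"
  where "RL_norm T q n p = L2_set (fst p) {1..n} + (\<Sum>i=1..n-1. Lq_norm T q (snd p i))"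

definition RL_open ::
    "real \<Rightarrow> real \<Rightarrow> nat \<Rightarrow> ((nat \<Rightarrow> real) \<times> (nat \<Rightarrow> real \<Rightarrow> real)) set \<Rightarrow> bool"
  where "RL_open T q n U \<longleftrightarrow> U \<subseteq> RL_space T q n \<and>
           (\<forall>x\<in>U. \<exists>e>0. \<forall>y\<in>RL_space T q n. RL_norm T q n (y - x) < e \<longrightarrow> y \<in> U)"

definition RL_topology ::
    "real \<Rightarrow> real \<Rightarrow> nat \<Rightarrow> ((nat \<Rightarrow> real) \<times> (nat \<Rightarrow> real \<Rightarrow> real)) topology"
  where "RL_topology T q n = topology (RL_open T q n)"

lemma istopology_RL_open: "istopology (RL_open T q n)"
  unfolding istopology_def
proof (intro conjI allI impI)
  fix S U assume S: "RL_open T q n S" and U: "RL_open T q n U"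
  show "RL_open T q n (S \<inter> U)"
    unfolding RL_open_def
  proof (intro conjI ballI)
    show "S \<inter> U \<subseteq> RL_space T q n" using S by (auto simp: RL_open_def)
    fix x assume x: "x \<in> S \<inter> U"
    obtain d where "d > 0" "\<forall>y\<in>RL_space T q n. RL_norm T q n (y - x) < d \<longrightarrow> y \<in> S"
      using S x unfolding RL_open_def by blast
    moreover obtain e where "e > 0" "\<forall>y\<in>RL_space T q n. RL_norm T q n (y - x) < e \<longrightarrow> y \<in> U"
      using U x unfolding RL_open_def by blast
    ultimately show "\<exists>e>0. \<forall>y\<in>RL_space T q n. RL_norm T q n (y - x) < e \<longrightarrow> y \<in> S \<inter> U"
      by (intro exI[of _ "min d e"]) auto
  qed
next
  fix K assume K: "\<forall>S\<in>K. RL_open T q n S"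
  show "RL_open T q n (\<Union>K)"
    unfolding RL_open_def
  proof (intro conjI ballI)
    show "\<Union>K \<subseteq> RL_space T q n" using K by (auto simp: RL_open_def)
    fix x assume "x \<in> \<Union>K"
    then obtain S where "S \<in> K" "x \<in> S" by blast
    with K obtain e where "e > 0" "\<forall>y\<in>RL_space T q n. RL_norm T q n (y - x) < e \<longrightarrow> y \<in> S"
      unfolding RL_open_def by blast
    with \<open>S \<in> K\<close> show "\<exists>e>0. \<forall>y\<in>RL_space T q n. RL_norm T q n (y - x) < e \<longrightarrow> y \<in> \<Union>K"
      by blast
  qed
qed

lemma openin_RL_topology: "openin (RL_topology T q n) = RL_open T q n"
  by (simp add: RL_topology_def istopology_RL_open)

lemma topspace_RL_topology: "topspace (RL_topology T q n) = RL_space T q n"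
proof (rule antisym)
  show "topspace (RL_topology T q n) \<subseteq> RL_space T q n"
    by (auto simp: topspace_def openin_RL_topology RL_open_def)
  have "RL_open T q n (RL_space T q n)"
    unfolding RL_open_def by (auto intro: exI[of _ "1 :: real"])
  then show "RL_space T q n \<subseteq> topspace (RL_topology T q n)"
    by (metis openin_RL_topology openin_subset)
qed

definition test_function :: "real \<Rightarrow> (real \<Rightarrow> real) \<Rightarrow> bool"
  where "test_function T \<phi> \<longleftrightarrow>
           (\<forall>k x. (deriv ^^ k) \<phi> field_differentiable (at x)) \<and>
           (\<exists>K. compact K \<and> K \<subseteq> {0<..<T} \<and> (\<forall>x. x \<notin> K \<longrightarrow> \<phi> x = 0))"

definition regular_Borel_measure :: "real \<Rightarrow> real measure \<Rightarrow> bool"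
  where "regular_Borel_measure T M \<longleftrightarrow>
           sets M = sets (restrict_space borel {0<..<T}) \<and> finite_measure M \<and>
           (\<forall>A\<in>sets M.
              emeasure M A = (SUP K\<in>{K. K \<subseteq> A \<and> compact K}. emeasure M K) \<and>
              emeasure M A = (INF U\<in>{U. A \<subseteq> U \<and> U \<subseteq> {0<..<T} \<and> open U}. emeasure M U))"

text \<open>A signed regular Borel measure on \<open>(0,T)\<close> is given as a difference \<open>M - N\<close> of two non-negative
  finite ones. The predicate says that \<open>Dv = M - N\<close> in the sense of distributions.\<close>

definition has_distr_deriv :: "real \<Rightarrow> (real \<Rightarrow> real) \<Rightarrow> real measure \<Rightarrow> real measure \<Rightarrow> bool"
  where "has_distr_deriv T v M N \<longleftrightarrow>
           regular_Borel_measure T M \<and> regular_Borel_measure T N \<and>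
           (\<forall>\<phi>. test_function T \<phi> \<longrightarrow>
              (LINT t|leb T. v t * deriv \<phi> t) = - ((LINT t|M. \<phi> t) - (LINT t|N. \<phi> t)))"

definition BV :: "real \<Rightarrow> (real \<Rightarrow> real) set"
  where "BV T = {v. integrable (leb T) v \<and> (\<exists>M N. has_distr_deriv T v M N)}"

definition BV01 :: "real \<Rightarrow> (real \<Rightarrow> real) set"
  where "BV01 T = {v \<in> BV T. AE t in leb T. v t \<in> {0..1}}"

definition distr_deriv_nonneg :: "real \<Rightarrow> (real \<Rightarrow> real) \<Rightarrow> bool"
  where "distr_deriv_nonneg T v \<longleftrightarrow> (\<exists>M. has_distr_deriv T v M (null_measure M))"

definition switching_points :: "real \<Rightarrow> nat \<Rightarrow> (nat \<Rightarrow> real) set"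
  where "switching_points T n =
           {\<tau> \<in> Rvec n. 0 \<le> \<tau> 1 \<and> (\<forall>i\<in>{1..n-1}. \<tau> i \<le> \<tau> (i + 1)) \<and> \<tau> n \<le> T}"

text \<open>\<open>c\<close> is the tuple of switching functions; the letter chi is a binder in the library.\<close>

definition feasible :: "real \<Rightarrow> real \<Rightarrow> nat \<Rightarrow> ((nat \<Rightarrow> real) \<times> (nat \<Rightarrow> real \<Rightarrow> real)) set"
  where "feasible T q n =
           {(\<tau>, c). \<tau> \<in> switching_points T n \<and> c \<in> Lq_vec T q (n - 1) \<and>
              (\<forall>i\<in>{1..n-1}. AE t in leb T. c i t = indicat_real {\<tau> i..<\<tau> (i + 1)} t)}"

definition feasible_ext ::
    "real \<Rightarrow> real \<Rightarrow> nat \<Rightarrow> ((nat \<Rightarrow> real) \<times> (nat \<Rightarrow> real \<Rightarrow> real) \<times> (nat \<Rightarrow> real \<Rightarrow> real)) set"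
  where "feasible_ext T q n =
           {(\<tau>, c, z). \<tau> \<in> Rvec n \<and> c \<in> Lq_vec T q (n - 1) \<and> z \<in> Lq_vec T q n \<and>
              (\<forall>i\<in>{1..n-1}. c i \<in> BV01 T) \<and>
              (\<forall>j\<in>{1..n}. z j \<in> BV01 T) \<and>
              (\<forall>i\<in>{1..n-1}. AE t in leb T. c i t = z i t - z (i + 1) t) \<and>
              (\<forall>i\<in>{2..n}. AE t in leb T. z i t \<le> z (i - 1) t) \<and>
              (\<forall>i\<in>{1..n}. distr_deriv_nonneg T (z i)) \<and>
              (\<forall>i\<in>{1..n}. \<tau> i = (LINT t|leb T. 1 - z i t))}"

end

theory Submission
  imports Defs "HOL-Probability.Helly_Selection" "HOL-Real_Asymp.Real_Asymp"
begin

text \<open>A function \<open>z\<close> with values in \<open>[0,1]\<close> has a non-negative distributional derivative iff it agrees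
  a.e. with a monotone function. One direction tests with primitives of differences of translated bumps,
  which shows that the primitive of \<open>z\<close> is convex; in the other one, \<open>Dz\<close> is the push-forward of the
  Lebesgue measure under the quantile function \<open>s \<mapsto> \<sigma>(s) = |{z \<le> s}|\<close>, by Fubini. After this
  reformulation, the projection is obviously convex and contains \<open>F\<close>, and it is closed by Helly's
  selection theorem. Conversely, \<open>z\<^sub>i\<close> is the average over the levels \<open>s \<in> (0,1)\<close> of the
  characteristic functions of \<open>{z\<^sub>i > s} = [\<sigma>\<^sub>i(s), T)\<close>, and for each level the points \<open>\<sigma>\<^sub>i(s)\<close> are
  feasible switching points; averaging over \<open>N\<close> equidistant levels gives convex combinations of
  feasible switching functions whose error is \<open>O(1/N)\<close>.\<close>

text \<open>Approximation in the closure concerns \<open>\<tau>\<close> and \<open>c\<close> only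
  and says nothing about the auxiliary \<open>z\<close>. The missing convergence comes from
  compactness of monotone functions with values in the unit interval, which is why a sign condition
  on a distribution has to become pointwise monotonicity first. In the other direction, one level
  \<open>s\<close> serves all indices at once: the order of the functions \<open>z i\<close> then
  orders their crossing points, so every level yields a feasible tuple. Both \<open>\<tau>\<close>
  and \<open>c\<close> depend affinely on the indicator functions of the superlevel sets, so the
  same uniform weights approximate both. With the midpoints of \<open>N\<close> equal cells of the
  unit interval as levels, averaging the indicators rounds each value \<open>z i t\<close> to a
  nearest multiple of \<open>1 / N\<close>; the error is therefore uniform in \<open>t\<close> and
  does not depend on \<open>z\<close>.\<close>

lemma borel_measurable_leb: "f \<in> borel_measurable borel \<Longrightarrow> f \<in> borel_measurable (leb T)"
  by (intro measurable_restrict_space1 measurable_completion) simp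

lemma finite_measure_leb: "finite_measure (leb T)"
  by (rule finite_measure_lebesgue_on) auto

subsection \<open>Monotone functions and non-negative distributional derivatives\<close>

definition flat_exp :: "nat \<Rightarrow> real \<Rightarrow> real"
  where "flat_exp k x = (if x > 0 then exp (- 1 / x) / x ^ k else 0)"

text \<open>The exponent \<open>k\<close> closes the family under differentiation up to linear
  combinations, so a single first-derivative computation covers all higher derivatives of
  exp(-1/x).\<close>

lemma flat_exp_has_derivative:
  "(flat_exp k has_real_derivative (flat_exp (k + 2) x - of_nat k * flat_exp (k + 1) x)) (at x)"
proof -
  consider "x > 0" | "x < 0" | "x = 0" by linarith
  then show ?thesis
  proof cases
    case 1
    have "((\<lambda>x. exp (- 1 / x) / x ^ k) has_real_derivative
            (exp (- 1 / x) / x\<^sup>2 * x ^ k - exp (- 1 / x) * (of_nat k * x ^ (k - 1))) / (x ^ k * x ^ k)) (at x)"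
      using 1 by (auto intro!: derivative_eq_intros simp: power2_eq_square)
    \<comment> \<open>At \<open>k = 0\<close> the truncated exponent \<open>k - 1\<close> is
      harmless because its term carries the factor \<open>of_nat k\<close>; hence the case
      split.\<close>
    also have "(exp (- 1 / x) / x\<^sup>2 * x ^ k - exp (- 1 / x) * (of_nat k * x ^ (k - 1))) / (x ^ k * x ^ k)
            = flat_exp (k + 2) x - of_nat k * flat_exp (k + 1) x"
      using 1 by (cases k) (simp_all add: flat_exp_def field_simps power2_eq_square)
    finally have "((\<lambda>x. exp (- 1 / x) / x ^ k) has_real_derivative
            flat_exp (k + 2) x - of_nat k * flat_exp (k + 1) x) (at x)" .
    then show ?thesis
      by (rule has_field_derivative_transform_within_open[of _ _ _ "{0<..}"]) (use 1 in \<open>auto simp: flat_exp_def\<close>)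
  next
    case 2
    have "((\<lambda>x. 0) has_real_derivative (flat_exp (k + 2) x - of_nat k * flat_exp (k + 1) x)) (at x)"
      using 2 by (auto simp: flat_exp_def)
    then show ?thesis
      by (rule has_field_derivative_transform_within_open[of _ _ _ "{..<0}"]) (use 2 in \<open>auto simp: flat_exp_def\<close>)
  next
    case 3
    \<comment> \<open>At the origin the left difference quotient is identically 0, and on the right
      the exponential beats every power of \<open>h\<close>.\<close>
    have "((\<lambda>h. exp (- 1 / h) / h ^ k / h) \<longlongrightarrow> 0) (at_right (0::real))"
      by real_asymp
    then have "((\<lambda>h. flat_exp k h / h) \<longlongrightarrow> 0) (at_right (0::real))"
      by (rule Lim_transform_eventually) (auto simp: flat_exp_def eventually_at_right_less eventually_at_filter)
    moreover have "((\<lambda>h. flat_exp k h / h) \<longlongrightarrow> 0) (at_left (0::real))"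
      by (rule Lim_transform_eventually[OF tendsto_const]) (auto simp: flat_exp_def eventually_at_filter)
    ultimately have "((\<lambda>h. flat_exp k h / h) \<longlongrightarrow> 0) (at (0::real))"
      by (simp add: filterlim_split_at)
    then show ?thesis
      using 3 by (simp add: DERIV_def flat_exp_def)
  qed
qed

text \<open>A class of real functions that is visibly closed under differentiation and hence consists of
  smooth functions; the bumps below are built inside it.\<close>

inductive smooth_class :: "(real \<Rightarrow> real) \<Rightarrow> bool" where
  const: "smooth_class (\<lambda>x. c)"
| flat_exp: "smooth_class (\<lambda>x. flat_exp k (a + b * x))"
| add: "smooth_class f \<Longrightarrow> smooth_class g \<Longrightarrow> smooth_class (\<lambda>x. f x + g x)"
| mult: "smooth_class f \<Longrightarrow> smooth_class g \<Longrightarrow> smooth_class (\<lambda>x. f x * g x)"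
| inverse: "smooth_class f \<Longrightarrow> (\<And>x. f x \<noteq> 0) \<Longrightarrow> smooth_class (\<lambda>x. inverse (f x))"
| antiderivative: "(\<And>x. (F has_real_derivative f x) (at x)) \<Longrightarrow> smooth_class f \<Longrightarrow> smooth_class F"

lemma smooth_has_derivative:
  assumes "smooth_class f"
  obtains f' where "smooth_class f'" "\<And>x. (f has_real_derivative f' x) (at x)"
proof -
  have "\<exists>f'. smooth_class f' \<and> (\<forall>x. (f has_real_derivative f' x) (at x))"
    using assms
  proof induction
    case (const c)
    show ?case by (intro exI[of _ "\<lambda>x. 0"]) (auto intro: smooth_class.const)
  next
    case (flat_exp k a b)
    have "((\<lambda>x. flat_exp k (a + b * x)) has_real_derivative
            (flat_exp (k + 2) (a + b * x) + (- of_nat k) * flat_exp (k + 1) (a + b * x)) * b) (at x)" for x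
      using DERIV_chain'[of "\<lambda>x. a + b * x" b x UNIV "flat_exp k", OF _ flat_exp_has_derivative]
      by (force intro!: derivative_eq_intros simp: mult.commute)
    moreover have "smooth_class (\<lambda>x. (flat_exp (k + 2) (a + b * x) + (- of_nat k) * flat_exp (k + 1) (a + b * x)) * b)"
      by (intro smooth_class.mult smooth_class.add smooth_class.const smooth_class.flat_exp)
    ultimately show ?case by blast
  next
    case (add f g)
    then show ?case by (blast intro: DERIV_add smooth_class.add)
  next
    case (mult f g)
    then obtain f' g' where "smooth_class f'" "smooth_class g'"
      "\<And>x. (f has_real_derivative f' x) (at x)" "\<And>x. (g has_real_derivative g' x) (at x)"
      by blast
    with mult.hyps show ?case
      by (intro exI[of _ "\<lambda>x. f' x * g x + g' x * f x"])
        (auto intro!: DERIV_mult smooth_class.add smooth_class.mult)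
  next
    case (inverse f)
    then obtain f' where f': "smooth_class f'" "\<And>x. (f has_real_derivative f' x) (at x)"
      by blast
    have "smooth_class (\<lambda>x. (- 1) * (inverse (f x) * f' x * inverse (f x)))"
      using inverse.hyps f' by (intro smooth_class.mult smooth_class.const smooth_class.inverse) auto
    moreover have "((\<lambda>x. inverse (f x)) has_real_derivative (- 1) * (inverse (f x) * f' x * inverse (f x))) (at x)" for x
      using DERIV_inverse'[OF f'(2) inverse.hyps(2), of x] by simp
    ultimately show ?case by blast
  next
    case (antiderivative F f)
    then show ?case by blast
  qed
  then show thesis using that by blast
qed

lemma smooth_iterated_deriv:
  assumes "smooth_class f"
  shows "smooth_class ((deriv ^^ k) f)"
proof (induction k)
  case (Suc k)
  from smooth_has_derivative[OF Suc]
  obtain g where g: "smooth_class g" "\<And>x. ((deriv ^^ k) f has_real_derivative g x) (at x)"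
    by metis
  then have "deriv ((deriv ^^ k) f) = g"
    by (auto intro: DERIV_imp_deriv)
  with g show ?case by simp
qed (use assms in simp)

lemma test_functionI:
  assumes "smooth_class \<phi>" "compact K" "K \<subseteq> {0<..<T}" "\<And>x. x \<notin> K \<Longrightarrow> \<phi> x = 0"
  shows "test_function T \<phi>"
  using assms smooth_iterated_deriv[OF assms(1)] unfolding test_function_def
  by (meson field_differentiable_def smooth_has_derivative)

lemma test_function_deriv_bounded:
  assumes "test_function T \<phi>"
  obtains B where "\<And>t. t \<in> {0..T} \<Longrightarrow> \<bar>deriv \<phi> t\<bar> \<le> B"
proof -
  have "(deriv ^^ 1) \<phi> field_differentiable (at x)" for x
    using assms unfolding test_function_def by blast
  then have "compact (deriv \<phi> ` {0..T})"
    by (intro compact_continuous_image continuous_at_imp_continuous_on)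
      (auto intro: field_differentiable_imp_continuous_at)
  then obtain B where "\<forall>t\<in>{0..T}. \<bar>deriv \<phi> t\<bar> \<le> B"
    by (auto dest!: compact_imp_bounded simp: bounded_iff)
  then show thesis using that by blast
qed

lemma test_function_deriv_measurable:
  assumes "test_function T \<phi>"
  shows "deriv \<phi> \<in> borel_measurable borel"
proof -
  have "(deriv ^^ 1) \<phi> field_differentiable (at x)" for x
    using assms unfolding test_function_def by blast
  then show ?thesis
    by (intro borel_measurable_continuous_onI continuous_at_imp_continuous_on)
      (auto intro: field_differentiable_imp_continuous_at)
qed

text \<open>The product \<open>p\<close> is positive exactly on the interval from \<open>a\<close>
  to \<open>a + h\<close>, so \<open>p / (p + 1 / Suc n)\<close> stays in the unit interval and
  tends to the indicator of that interval. Only \<open>x - a\<close> and \<open>a + h - x\<close>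
  enter, hence bumps of equal width are translates of each other.\<close>

definition bump :: "nat \<Rightarrow> real \<Rightarrow> real \<Rightarrow> real \<Rightarrow> real"
  where "bump n a h x = (let p = flat_exp 0 (x - a) * flat_exp 0 (a + h - x) in p / (p + 1 / Suc n))"

lemma flat_exp_nonneg: "0 \<le> flat_exp 0 x" by (simp add: flat_exp_def)

lemma smooth_bump: "smooth_class (bump n a h)"
proof -
  have *: "smooth_class (\<lambda>x. flat_exp 0 (x - a) * flat_exp 0 (a + h - x))"
    using smooth_class.mult[OF smooth_class.flat_exp[of 0 "- a" 1] smooth_class.flat_exp[of 0 "a + h" "- 1"]]
    by (simp add: add.commute[of "- a"])
  have "flat_exp 0 (x - a) * flat_exp 0 (a + h - x) + 1 / Suc n \<noteq> 0" for x
    using mult_nonneg_nonneg[OF flat_exp_nonneg flat_exp_nonneg] by (smt (verit) of_nat_0_less_iff zero_less_Suc zero_less_divide_1_iff)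
  then have "smooth_class (\<lambda>x. flat_exp 0 (x - a) * flat_exp 0 (a + h - x) * inverse (flat_exp 0 (x - a) * flat_exp 0 (a + h - x) + 1 / Suc n))"
    by (intro smooth_class.mult[OF * smooth_class.inverse[OF smooth_class.add[OF * smooth_class.const]]])
  then show ?thesis
    by (simp add: bump_def[abs_def] Let_def divide_inverse)
qed

lemma bump_bounds: "0 \<le> bump n a h x" "bump n a h x \<le> 1"
  using mult_nonneg_nonneg[OF flat_exp_nonneg flat_exp_nonneg, of "x - a" "a + h - x"]
  by (auto simp: bump_def Let_def divide_simps add_nonneg_pos add_pos_nonneg intro!: add_nonneg_nonneg)

lemma bump_outside: "x \<notin> {a<..<a+h} \<Longrightarrow> bump n a h x = 0"
  by (auto simp: bump_def flat_exp_def Let_def)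

lemma bump_tendsto: "(\<lambda>n. bump n a h x) \<longlonglongrightarrow> indicat_real {a<..<a+h} x"
proof (cases "x \<in> {a<..<a+h}")
  case True
  define p where "p = flat_exp 0 (x - a) * flat_exp 0 (a + h - x)"
  have "p > 0" using True by (simp add: p_def flat_exp_def)
  have "(\<lambda>n. p / (p + 1 / Suc n)) \<longlonglongrightarrow> p / (p + 0)"
    using \<open>p > 0\<close> by (intro tendsto_intros LIMSEQ_Suc[OF lim_1_over_n]) auto
  then show ?thesis using True \<open>p > 0\<close> by (simp add: bump_def Let_def flip: p_def)
qed (simp add: bump_outside)

lemma bump_shift: "bump n (a + d) h (x + d) = bump n a h x"
proof -
  have "x + d - (a + d) = x - a" "a + d + h - (x + d) = a + h - x" by simp_all
  then show ?thesis by (simp only: bump_def)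
qed

text \<open>Testing with a primitive of the difference of two bumps: the primitive is non-negative and
  compactly supported because the bumps are translates of each other.\<close>

lemma bump_test_function:
  assumes "0 < a" "a < b" "0 < h" "b + h < T"
  obtains \<phi> where "test_function T \<phi>" "\<And>x. 0 \<le> \<phi> x"
    "\<And>x. deriv \<phi> x = bump n a h x - bump n b h x"
proof -
  have cont: "continuous_on UNIV (bump n a h)"
    using smooth_has_derivative[OF smooth_bump]
    by (metis DERIV_isCont continuous_at_imp_continuous_on)
  obtain R where "\<forall>x. - \<infinity> < ereal x \<longrightarrow> ereal x < \<infinity> \<longrightarrow> (R has_vector_derivative bump n a h x) (at x)"
    using einterval_antiderivative[of "- \<infinity>" \<infinity> "bump n a h"] cont
    by (auto simp: continuous_on_eq_continuous_at)
  then have R: "(R has_real_derivative bump n a h x) (at x)" for x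
    by (simp add: has_real_derivative_iff_has_vector_derivative)
  have R_mono: "R x \<le> R y" if "x \<le> y" for x y
    using that by (rule DERIV_nonneg_imp_nondecreasing) (use R bump_bounds in blast)
  have R_left: "R x = R a" if "x \<le> a" for x
  proof (rule antisym)
    show "R a \<le> R x"
      using that
    proof (rule DERIV_nonpos_imp_nonincreasing)
      fix t assume "x \<le> t" "t \<le> a"
      then show "\<exists>y. (R has_real_derivative y) (at t) \<and> y \<le> 0"
        using R[of t] bump_outside[of t a h n] by auto
    qed
  qed (use R_mono that in blast)
  have R_right: "R x = R (a + h)" if "a + h \<le> x" for x
  proof (rule antisym)
    show "R x \<le> R (a + h)"
      using that
    proof (rule DERIV_nonpos_imp_nonincreasing)
      fix t assume "a + h \<le> t" "t \<le> x"
      then show "\<exists>y. (R has_real_derivative y) (at t) \<and> y \<le> 0"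
        using R[of t] bump_outside[of t a h n] by auto
    qed
  qed (use R_mono that in blast)
  \<comment> \<open>\<open>R\<close> is constant to the left of \<open>a\<close> and to the right of
    \<open>a + h\<close>, so the difference vanishes outside \<open>{a..b + h}\<close>. It is
    non-negative because \<open>R\<close> is nondecreasing and \<open>a < b\<close>.\<close>
  define \<phi> where "\<phi> x = R x - R (x - (b - a))" for x
  have "((\<lambda>x. R (x - (b - a))) has_real_derivative bump n a h (x - (b - a)) * 1) (at x)" for x
    by (rule DERIV_chain2[OF R]) (auto intro!: derivative_eq_intros)
  moreover have "bump n a h (x - (b - a)) = bump n b h x" for x
    using bump_shift[of n a "b - a" h "x - (b - a)"] by simp
  ultimately have d: "(\<phi> has_real_derivative bump n a h x - bump n b h x) (at x)" for x
    unfolding \<phi>_def by (intro DERIV_diff R) simp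
  \<comment> \<open>\<open>R\<close> is known only through its derivative; the rule
    \<open>antiderivative\<close> of \<open>smooth_class\<close> carries smoothness from the
    derivative over to \<open>\<phi>\<close>.\<close>
  have "smooth_class (\<lambda>x. bump n a h x + (- 1) * bump n b h x)"
    by (intro smooth_class.add smooth_class.mult smooth_class.const smooth_bump)
  then have "smooth_class \<phi>"
    using d by (intro smooth_class.antiderivative[of \<phi> "\<lambda>x. bump n a h x - bump n b h x"]) auto
  moreover have "\<phi> x = 0" if "x \<notin> {a..b + h}" for x
  proof -
    from that consider "x \<le> a" | "x \<ge> b + h" by force
    then show ?thesis
    proof cases
      case 1
      then have "R x = R a" "R (x - (b - a)) = R a"
        using assms by (auto intro!: R_left)
      then show ?thesis by (simp add: \<phi>_def)
    next
      case 2
      then have "R x = R (a + h)" "R (x - (b - a)) = R (a + h)"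
        using assms by (auto intro!: R_right)
      then show ?thesis by (simp add: \<phi>_def)
    qed
  qed
  ultimately have "test_function T \<phi>"
    using assms by (intro test_functionI[of \<phi> "{a..b + h}"]) auto
  moreover have "0 \<le> \<phi> x" for x
    using R_mono[of "x - (b - a)" x] assms by (simp add: \<phi>_def)
  ultimately show thesis
    using that DERIV_imp_deriv[OF d] by blast
qed

section \<open>From a non-negative derivative to a monotone representative\<close>

lemma distr_deriv_nonneg_integral_le:
  assumes u: "distr_deriv_nonneg T u" "u \<in> borel_measurable (leb T)" "AE t in leb T. u t \<in> {0..1}"
    and ab: "0 < a" "a < b" "0 < h" "b + h < T"
  shows "(LINT t|leb T. u t * indicat_real {a<..<a+h} t) \<le> (LINT t|leb T. u t * indicat_real {b<..<b+h} t)"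
proof -
  obtain M where M: "has_distr_deriv T u M (null_measure M)"
    using u(1) by (auto simp: distr_deriv_nonneg_def)
  have [measurable]: "u \<in> borel_measurable (leb T)" by fact
  have bm: "bump n c h \<in> borel_measurable (leb T)" for n c
  proof -
    have "continuous_on UNIV (bump n c h)"
      using smooth_has_derivative[OF smooth_bump]
      by (metis DERIV_isCont continuous_at_imp_continuous_on)
    then show ?thesis
      by (intro borel_measurable_leb borel_measurable_continuous_onI)
  qed
  have im: "indicat_real {c<..<c+h} \<in> borel_measurable (leb T)" for c
    by (intro borel_measurable_leb) simp
  \<comment> \<open>A non-negative test function makes the sign of \<open>M\<close> visible. The
    limit in \<open>n\<close> then turns the bumps into windows: the integral of \<open>u\<close>
    over a window of fixed length grows as the window moves to the right.\<close>
  have "(LINT t|leb T. u t * (bump n a h t - bump n b h t)) \<le> 0" for n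
  proof -
    obtain \<phi> where \<phi>: "test_function T \<phi>" "\<And>x. 0 \<le> \<phi> x"
        "\<And>x. deriv \<phi> x = bump n a h x - bump n b h x"
      using bump_test_function[OF ab] by blast
    have "(LINT t|leb T. u t * deriv \<phi> t) = - ((LINT t|M. \<phi> t) - (LINT t|null_measure M. \<phi> t))"
      using M \<phi>(1) by (simp add: has_distr_deriv_def)
    also have "\<dots> \<le> 0"
      using \<phi>(2) by (simp add: integral_null_measure)
    finally show ?thesis by (simp add: \<phi>(3))
  qed
  moreover have "(\<lambda>n. LINT t|leb T. u t * (bump n a h t - bump n b h t)) \<longlonglongrightarrow>
      (LINT t|leb T. u t * (indicat_real {a<..<a+h} t - indicat_real {b<..<b+h} t))"
  proof (rule integral_dominated_convergence[where w = "\<lambda>_. 1"])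
    show "AE t in leb T. norm (u t * (bump n a h t - bump n b h t)) \<le> 1" for n
      using u(3)
    proof eventually_elim
      case (elim t)
      have "\<bar>bump n a h t - bump n b h t\<bar> \<le> 1"
        using bump_bounds[of n a h t] bump_bounds[of n b h t] by linarith
      then have "\<bar>u t\<bar> * \<bar>bump n a h t - bump n b h t\<bar> \<le> 1 * 1"
        using elim by (intro mult_mono) auto
      then show ?case by (simp add: abs_mult)
    qed
    show "integrable (leb T) (\<lambda>_. 1 :: real)"
      by (simp add: finite_measure.integrable_const finite_measure_leb)
  qed (auto intro!: tendsto_intros bump_tendsto borel_measurable_times borel_measurable_diff bm im u(2))
  ultimately have "(LINT t|leb T. u t * (indicat_real {a<..<a+h} t - indicat_real {b<..<b+h} t)) \<le> 0"
    by (intro LIMSEQ_le_const2) auto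
  moreover have int: "integrable (leb T) (\<lambda>t. u t * indicat_real {c<..<c+h} t)" for c
  proof (rule finite_measure.integrable_const_bound[OF finite_measure_leb, where B = 1])
    show "AE t in leb T. norm (u t * indicat_real {c<..<c+h} t) \<le> 1"
      using u(3) by eventually_elim (auto simp: indicator_def)
  qed (intro borel_measurable_times im u(2))
  ultimately show ?thesis
    by (simp add: right_diff_distrib Bochner_Integration.integral_diff[OF int int])
qed

text \<open>A finite Borel measure on the line is determined by its values on the tails
  \<open>{x<..}\<close>. Hence the two densities, cut off to \<open>{a..b}\<close>, define the same
  measure, and densities with respect to \<open>lborel\<close> are unique a.e.; no differentiation
  of integrals is involved.\<close>

lemma AE_eq_if_integral_eq:
  fixes u w :: "real \<Rightarrow> real"
  assumes [measurable]: "u \<in> borel_measurable borel" "w \<in> borel_measurable borel"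
    and nonneg: "\<And>t. 0 \<le> u t" "\<And>t. 0 \<le> w t"
    and int: "u integrable_on {a..b}" "w integrable_on {a..b}"
    and eq: "\<And>x. a \<le> x \<Longrightarrow> x \<le> b \<Longrightarrow> integral {x..b} u = integral {x..b} w"
  shows "AE t in lborel. t \<in> {a..b} \<longrightarrow> u t = w t"
proof -
  define M where "M f = density lborel (\<lambda>t. ennreal (f t) * indicator {a..b} t)" for f :: "real \<Rightarrow> real"
  have em: "emeasure (M f) {x<..} = ennreal (integral {max a x..b} f)"
    if [measurable]: "f \<in> borel_measurable borel" and f: "\<And>t. 0 \<le> f t" "f integrable_on {a..b}"
    for f :: "real \<Rightarrow> real" and x
  proof -
    have "emeasure (M f) {x<..} = (\<integral>\<^sup>+t. ennreal (f t) * indicator {a..b} t * indicator {x<..} t \<partial>lborel)"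
      by (simp add: M_def emeasure_density)
    also have "\<dots> = (\<integral>\<^sup>+t. ennreal (indicator {max a x..b} t * f t) \<partial>lborel)"
      using AE_lborel_singleton[of x]
      by (intro nn_integral_cong_AE) (auto elim!: eventually_mono simp: indicator_def)
    also have "\<dots> = ennreal (integral {max a x..b} f)"
    proof (rule nn_integral_has_integral_lebesgue)
      show "(f has_integral integral {max a x..b} f) {max a x..b}"
        by (intro integrable_integral integrable_on_subinterval[OF f(2)]) auto
    qed (use f in auto)
    finally show ?thesis .
  qed
  have "M u = M w"
  proof (rule measure_eqI_lessThan)
    show "emeasure (M u) {x<..} < \<infinity>" for x
      using em[of u x] nonneg int by simp
    show "emeasure (M u) {x<..} = emeasure (M w) {x<..}" for x
    proof (cases "max a x \<le> b")
      case True
      then show ?thesis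
        using em[of u x] em[of w x] nonneg int eq[of "max a x"] by simp
    next
      case False
      then show ?thesis
        using em[of u x] em[of w x] nonneg int by simp
    qed
  qed (auto simp: M_def)
  then have "AE t in lborel. ennreal (u t) * indicator {a..b} t = ennreal (w t) * indicator {a..b} t"
    unfolding M_def by (subst (asm) sigma_finite_measure.density_unique_iff[OF sigma_finite_lborel]) auto
  then show ?thesis
    by eventually_elim (use nonneg in \<open>auto simp: indicator_def\<close>)
qed

lemma integrable_on_unit_bounded:
  fixes u :: "real \<Rightarrow> real"
  assumes "u \<in> borel_measurable borel" "\<And>t. 0 \<le> u t" "\<And>t. u t \<le> 1"
  shows "u integrable_on {a..b}"
  by (rule measurable_bounded_by_integrable_imp_integrable_real[of _ _ "\<lambda>_. 1"])
    (use assms in \<open>auto intro!: measurable_restrict_space1 measurable_completion\<close>)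

text \<open>The hypothesis says that the primitive \<open>Z\<close> of \<open>u\<close> is convex, so the difference quotients of \<open>Z\<close>
  along dyadic steps decrease to a monotone function.\<close>

lemma AE_mono_if_averages_mono:
  fixes u :: "real \<Rightarrow> real"
  assumes u: "u \<in> borel_measurable borel" "\<And>t. 0 \<le> u t" "\<And>t. u t \<le> 1"
    and le: "\<And>a b h. 0 < a \<Longrightarrow> a < b \<Longrightarrow> 0 < h \<Longrightarrow> b + h < T \<Longrightarrow>
                integral {a..a+h} u \<le> integral {b..b+h} u"
  obtains w where "mono w" "\<And>t. 0 \<le> w t" "\<And>t. w t \<le> 1"
    "AE t in lborel. t \<in> {0<..<T} \<longrightarrow> u t = w t"
proof -
  have int: "u integrable_on {a..b}" for a b
    by (rule integrable_on_unit_bounded[OF u])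
  define Z where "Z t = integral {0..t} u" for t
  have Z_diff: "Z t - Z s = integral {s..t} u" if "0 \<le> s" "s \<le> t" for s t
    using Henstock_Kurzweil_Integration.integral_combine[OF that int] by (simp add: Z_def)
  have Z_bounds: "0 \<le> Z t - Z s" "Z t - Z s \<le> t - s" if "0 \<le> s" "s \<le> t" for s t
  proof -
    show "0 \<le> Z t - Z s"
      unfolding Z_diff[OF that] using int u by (intro Henstock_Kurzweil_Integration.integral_nonneg) auto
    have "integral {s..t} u \<le> integral {s..t} (\<lambda>_. 1)"
      using int u by (intro integral_le) auto
    then show "Z t - Z s \<le> t - s"
      unfolding Z_diff[OF that] using that by simp
  qed
  have Z_cont: "continuous_on {0..c} Z" for c
    unfolding Z_def by (rule indefinite_integral_continuous_1[OF int])
  define h where "h n = (1 / 2 :: real) ^ n" for n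
  have h_pos: "0 < h n" for n by (simp add: h_def)
  have h_le: "h n \<le> 1" for n by (simp add: h_def power_le_one)
  have h_lim: "h \<longlonglongrightarrow> 0" unfolding h_def by (intro LIMSEQ_power_zero) simp
  define D where "D n t = (Z (t + h n) - Z t) / h n" for n t
  have D_bounds: "0 \<le> D n t" "D n t \<le> 1" if "0 \<le> t" for n t
    using Z_bounds[of t "t + h n"] that h_pos[of n] by (auto simp: D_def field_simps)
  have D_dec: "D (Suc n) t \<le> D n t" if "0 < t" "t + h n < T" for n t
  proof -
    have h: "h n = h (Suc n) + h (Suc n)" by (simp add: h_def)
    \<comment> \<open>Halving the step splits the window at \<open>t\<close> into two adjacent
      windows of equal length, and the left one carries at most the mass of the right one.\<close>
    have "Z (t + h (Suc n)) - Z t \<le> Z (t + h n) - Z (t + h (Suc n))"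
      using le[of t "t + h (Suc n)" "h (Suc n)"] that h_pos[of "Suc n"]
      by (simp add: Z_diff h add.assoc)
    then have "2 * (Z (t + h (Suc n)) - Z t) / h n \<le> (Z (t + h n) - Z t) / h n"
      using h_pos[of n] by (intro divide_right_mono) (simp_all add: h)
    moreover have "D (Suc n) t = 2 * (Z (t + h (Suc n)) - Z t) / h n"
      by (simp add: D_def h_def)
    ultimately show ?thesis by (simp only: D_def)
  qed
  have ev_h: "eventually (\<lambda>n. h n < e) sequentially" if "0 < e" for e
    using order_tendstoD(2)[OF h_lim that] .
  have conv: "convergent (\<lambda>n. D n t)" if t: "0 < t" "t < T" for t
  proof -
    obtain N where N: "\<And>n. n \<ge> N \<Longrightarrow> h n < T - t"
      using ev_h[of "T - t"] t by (auto simp: eventually_sequentially)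
    \<comment> \<open>The comparison needs the whole window to lie inside the interval, which holds
      only from index \<open>N\<close> on.\<close>
    have "decseq (\<lambda>n. D (n + N) t)"
      unfolding decseq_Suc_iff using D_dec[of t] N t by (simp add: less_diff_eq add.commute)
    moreover have "\<forall>n. 0 \<le> D (n + N) t" using D_bounds t by simp
    ultimately obtain L where "(\<lambda>n. D (n + N) t) \<longlonglongrightarrow> L"
      by (rule decseq_convergent)
    then show ?thesis
      by (auto simp: convergent_def dest: LIMSEQ_offset)
  qed
  \<comment> \<open>With the extreme values 0 and 1 outside the interval, monotonicity across the
    endpoints follows from the bounds alone.\<close>
  define w where "w t = (if t \<le> 0 then 0 else if t < T then lim (\<lambda>n. D n t) else 1)" for t
  have D_lim: "(\<lambda>n. D n t) \<longlonglongrightarrow> w t" if "0 < t" "t < T" for t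
    using conv[OF that] that by (simp add: w_def convergent_LIMSEQ_iff)
  have w_bounds: "0 \<le> w t" "w t \<le> 1" for t
  proof -
    have "0 \<le> w t \<and> w t \<le> 1" if "0 < t" "t < T"
      using LIMSEQ_le_const[OF D_lim[OF that]] LIMSEQ_le_const2[OF D_lim[OF that]] D_bounds that
      by (meson less_imp_le)
    then show "0 \<le> w t" "w t \<le> 1" by (auto simp: w_def)
  qed
  have "mono w"
  proof (rule monoI)
    fix s t :: real assume "s \<le> t"
    consider "s \<le> 0" | "T \<le> t" | "s = t" | "0 < s" "s < t" "t < T" using \<open>s \<le> t\<close> by linarith
    then show "w s \<le> w t"
    proof cases
      case 1
      then show ?thesis using w_bounds[of t] by (simp add: w_def)
    next
      case 2
      then show ?thesis using w_bounds[of s] \<open>s \<le> t\<close> by (auto simp: w_def)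
    next
      case 4
      have "\<exists>N. \<forall>n\<ge>N. D n s \<le> D n t"
      proof -
        obtain N where "\<And>n. n \<ge> N \<Longrightarrow> h n < T - t"
          using ev_h[of "T - t"] 4 by (auto simp: eventually_sequentially)
        then have "D n s \<le> D n t" if "n \<ge> N" for n
          using le[of s t "h n"] 4 h_pos[of n] that
          by (auto simp: D_def Z_diff less_diff_eq add.commute intro!: divide_right_mono)
        then show ?thesis by blast
      qed
      then show ?thesis
        using LIMSEQ_le[OF D_lim D_lim, of s t] 4 by simp
    qed simp
  qed
  then have w_meas: "w \<in> borel_measurable borel" by (rule borel_measurable_mono)
  \<comment> \<open>A second primitive of \<open>u\<close>: the difference quotient of
    \<open>G\<close> is an antiderivative of \<open>D n\<close>, so the integral of
    \<open>D n\<close> is known exactly. Its limit needs only differentiability of \<open>G\<close>,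
    that is, continuity of \<open>Z\<close>; \<open>Z\<close> itself is never
    differentiated.\<close>
  define G where "G x = integral {0..x} Z" for x
  have G: "(G has_real_derivative Z x) (at x)" if "0 < x" for x
  proof -
    have "(G has_real_derivative Z x) (at x within {0..x+1})"
      unfolding G_def by (rule integral_has_real_derivative[OF Z_cont]) (use that in auto)
    then show ?thesis
      using that by (simp add: at_within_Icc_at)
  qed
  have quot: "(\<lambda>n. (G (x + h n) - G x) / h n) \<longlonglongrightarrow> Z x" if "0 < x" for x
  proof -
    have "((\<lambda>k. (G (x + k) - G x) / k) \<longlongrightarrow> Z x) (at 0)"
      using G[OF that] by (simp add: DERIV_def)
    moreover have "filterlim h (at 0) sequentially"
      using h_lim h_pos by (auto simp: filterlim_at intro!: always_eventually) (metis less_irrefl)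
    ultimately show ?thesis
      by (rule filterlim_compose[of "\<lambda>k. (G (x + k) - G x) / k"])
  qed
  have eq: "integral {a..b} u = integral {a..b} w" if ab: "0 < a" "a \<le> b" "b < T" for a b
  proof -
    have D_int: "(D n has_integral ((G (b + h n) - G b) / h n - (G (a + h n) - G a) / h n)) {a..b}" for n
    proof -
      have "((\<lambda>x. (G (x + h n) - G x) / h n) has_vector_derivative D n x) (at x within {a..b})"
        if "x \<in> {a..b}" for x
      proof -
        have "((\<lambda>x. G (x + h n)) has_real_derivative Z (x + h n) * 1) (at x)"
          by (rule DERIV_chain2[OF G]) (use that ab h_pos[of n] in \<open>auto intro!: derivative_eq_intros\<close>)
        moreover have "(G has_real_derivative Z x) (at x)"
          by (rule G) (use that ab in auto)
        ultimately have "((\<lambda>x. (G (x + h n) - G x) / h n) has_real_derivative D n x) (at x)"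
          unfolding D_def by (intro DERIV_cdivide DERIV_diff) simp_all
        then show ?thesis
          by (simp add: has_real_derivative_iff_has_vector_derivative has_vector_derivative_at_within)
      qed
      then have "(D n has_integral ((G (b + h n) - G b) / h n - (G (a + h n) - G a) / h n)) {a..b}"
        using ab(2) by (intro fundamental_theorem_of_calculus) auto
      then show ?thesis .
    qed
    have "(\<lambda>n. integral {a..b} (D n)) \<longlonglongrightarrow> integral {a..b} w"
    proof (rule dominated_convergence(2)[where h = "\<lambda>_. 1"])
      show "D n integrable_on {a..b}" for n using D_int by blast
    qed (use ab D_bounds D_lim in auto)
    moreover have "(\<lambda>n. integral {a..b} (D n)) \<longlonglongrightarrow> Z b - Z a"
      unfolding integral_unique[OF D_int] using ab by (intro tendsto_diff quot) auto
    ultimately have "integral {a..b} w = Z b - Z a" by (rule LIMSEQ_unique)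
    then show ?thesis using Z_diff[of a b] ab by simp
  qed
  \<comment> \<open>The integrals are compared only strictly inside the interval, hence the
    exhaustion by countably many compact intervals.\<close>
  have "AE t in lborel. t \<in> {1 / Suc n..T - 1 / Suc n} \<longrightarrow> u t = w t" for n
  proof (rule AE_eq_if_integral_eq[OF u(1) w_meas u(2) w_bounds(1) int])
    show "w integrable_on {1 / Suc n..T - 1 / Suc n}"
      by (intro integrable_on_unit_bounded w_meas w_bounds)
    have "0 < 1 / Suc n" by simp
    then show "integral {x..T - 1 / Suc n} u = integral {x..T - 1 / Suc n} w"
      if "1 / Suc n \<le> x" "x \<le> T - 1 / Suc n" for x
      using that by (intro eq) linarith+
  qed
  then have "AE t in lborel. \<forall>n. t \<in> {1 / Suc n..T - 1 / Suc n} \<longrightarrow> u t = w t"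
    by (subst AE_all_countable) blast
  then have "AE t in lborel. t \<in> {0<..<T} \<longrightarrow> u t = w t"
  proof eventually_elim
    case (elim t)
    show ?case
    proof
      assume "t \<in> {0<..<T}"
      then have "0 < min t (T - t)" by simp
      then obtain n where "inverse (real (Suc n)) < min t (T - t)"
        using reals_Archimedean by blast
      then show "u t = w t" using elim[rule_format, of n] by (simp add: field_simps inverse_eq_divide)
    qed
  qed
  with \<open>mono w\<close> w_bounds show thesis by (intro that)
qed

text \<open>The right limit, written as an infimum, agrees with \<open>u\<close> wherever
  \<open>u\<close> is continuous, and a monotone function has only countably many
  discontinuities.\<close>

lemma right_continuous_version:
  fixes u :: "real \<Rightarrow> real"
  assumes u: "mono u" "\<And>t. 0 \<le> u t" "\<And>t. u t \<le> 1"
  obtains v where "mono v" "\<And>t. 0 \<le> v t" "\<And>t. v t \<le> 1" "\<And>t. continuous (at_right t) v"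
    "AE t in lborel. u t = v t"
proof -
  define v where "v x = Inf (u ` {x<..})" for x
  have bdd: "bdd_below (u ` A)" for A using u(2) by (auto intro: bdd_belowI[of _ 0])
  have v_le: "v x \<le> u y" if "x < y" for x y
    unfolding v_def using that by (intro cINF_lower bdd) auto
  have le_v: "u x \<le> v x" for x
    unfolding v_def using monoD[OF u(1)] by (intro cINF_greatest) auto
  have "mono v"
  proof (rule monoI)
    fix x y :: real assume "x \<le> y"
    then show "v x \<le> v y"
      unfolding v_def by (intro cINF_superset_mono bdd) auto
  qed
  moreover have "continuous (at_right x) v" for x
    unfolding continuous_within order_tendsto_iff
  proof (intro conjI allI impI)
    fix l assume "l < v x"
    then show "eventually (\<lambda>y. l < v y) (at_right x)"
      using monoD[OF \<open>mono v\<close>] eventually_at_right_less[of x]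
      by (auto elim!: eventually_mono intro: less_le_trans)
  next
    fix l assume "v x < l"
    then obtain y where "x < y" "u y < l"
      unfolding v_def by (subst (asm) cINF_less_iff) (auto intro: bdd)
    then show "eventually (\<lambda>y. v y < l) (at_right x)"
      using v_le by (auto simp: eventually_at_right_field intro!: exI[of _ y] intro: le_less_trans)
  qed
  moreover have "u x = v x" if "isCont u x" for x
  proof (rule antisym[OF le_v])
    have "(u \<longlongrightarrow> u x) (at_right x)"
      using that by (auto simp: isCont_def intro: filterlim_at_split[THEN iffD1, THEN conjunct2])
    then show "v x \<le> u x"
      by (rule tendsto_lowerbound) (use v_le eventually_at_right_less[of x] in \<open>auto elim!: eventually_mono\<close>)
  qed
  then have "AE t in lborel. u t = v t"
    by (intro AE_I'[of "{t. \<not> isCont u t}"] countable_imp_null_set_lborel mono_ctble_discont u) auto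
  moreover have "0 \<le> v t" "v t \<le> 1" for t
    using order_trans[OF u(2)[of t] le_v] order_trans[OF v_le[of t "t + 1"] u(3)] by auto
  ultimately show thesis by (intro that)
qed

lemma AE_leb_iff: "(AE t in leb T. P t) \<longleftrightarrow> (AE t in lborel. t \<in> {0<..<T} \<longrightarrow> P t)"
  by (simp add: AE_restrict_space_iff AE_completion_iff)

text \<open>Right continuity is a normalization at the cost of a null set. It is imposed, like
  monotonicity, on the whole line because Helly selection works with right-continuous functions
  there.\<close>

definition unit_monotone :: "(real \<Rightarrow> real) \<Rightarrow> bool"
  where "unit_monotone z \<longleftrightarrow> mono z \<and> (\<forall>t. z t \<in> {0..1}) \<and> (\<forall>t. continuous (at_right t) z)"

lemma distr_deriv_nonneg_imp_unit_monotone: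
  assumes u: "distr_deriv_nonneg T u" "u \<in> borel_measurable (leb T)" "AE t in leb T. u t \<in> {0..1}"
  obtains v where "unit_monotone v" "AE t in leb T. u t = v t"
proof -
  have "(\<lambda>t. indicator {0<..<T} t *\<^sub>R u t) \<in> borel_measurable lebesgue"
    using u(2) by (subst (asm) borel_measurable_restrict_space_iff) auto
  then obtain u1 where u1: "u1 \<in> borel_measurable lborel"
      "AE t in lborel. indicator {0<..<T} t *\<^sub>R u t = u1 t"
    using completion_ex_borel_measurable_real by blast
  \<comment> \<open>\<open>u\<close> is only Lebesgue measurable and bounded only a.e.; a Borel
    version clamped to the unit interval meets the pointwise hypotheses below and has the same
    window integrals.\<close>
  define u2 where "u2 t = max 0 (min 1 (u1 t))" for t
  have u2: "u2 \<in> borel_measurable borel" "\<And>t. 0 \<le> u2 t" "\<And>t. u2 t \<le> 1"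
    using u1(1) by (auto simp: u2_def[abs_def])
  have eq: "AE t in leb T. u t = u2 t"
    using u1(2) u(3) unfolding AE_leb_iff by eventually_elim (auto simp: u2_def)
  have int: "(LINT t|leb T. u t * indicat_real {a<..<a+h} t) = integral {a..a+h} u2"
    if "0 < a" "0 < h" "a + h < T" for a h
  proof -
    have m: "(\<lambda>t. u2 t * indicat_real {a<..<a+h} t) \<in> borel_measurable (leb T)"
      using u2(1) by (intro borel_measurable_leb) auto
    have "(LINT t|leb T. u t * indicat_real {a<..<a+h} t) = (LINT t|leb T. u2 t * indicat_real {a<..<a+h} t)"
    proof (rule integral_cong_AE[OF _ m])
      show "(\<lambda>t. u t * indicat_real {a<..<a+h} t) \<in> borel_measurable (leb T)"
        by (intro borel_measurable_times u(2) borel_measurable_leb) simp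
      show "AE t in leb T. u t * indicat_real {a<..<a+h} t = u2 t * indicat_real {a<..<a+h} t"
        using eq by eventually_elim simp
    qed
    also have "\<dots> = integral {0<..<T} (\<lambda>t. u2 t * indicat_real {a<..<a+h} t)"
    proof (rule lebesgue_integral_eq_integral)
      show "integrable (leb T) (\<lambda>t. u2 t * indicat_real {a<..<a+h} t)"
        by (rule finite_measure.integrable_const_bound[OF finite_measure_leb, where B = 1]) (use u2 m in \<open>auto simp: indicator_def\<close>)
    qed auto
    also have "\<dots> = integral {0<..<T} (\<lambda>t. if t \<in> {a<..<a+h} then u2 t else 0)"
      by (intro Henstock_Kurzweil_Integration.integral_cong) (auto simp: indicator_def)
    also have "\<dots> = integral {a<..<a+h} u2"
      using that by (subst integral_restrict_Int) (auto simp: Int_absorb2)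
    also have "\<dots> = integral {a..a+h} u2"
      by (rule integral_open_interval_real[symmetric])
    finally show ?thesis .
  qed
  have le: "integral {a..a+h} u2 \<le> integral {b..b+h} u2"
    if "0 < a" "a < b" "0 < h" "b + h < T" for a b h
    using distr_deriv_nonneg_integral_le[OF u that] int[of a h] int[of b h] that by simp
  obtain w where w: "mono w" "\<And>t. 0 \<le> w t" "\<And>t. w t \<le> 1"
      "AE t in lborel. t \<in> {0<..<T} \<longrightarrow> u2 t = w t"
    using AE_mono_if_averages_mono[OF u2 le] by blast
  obtain v where v: "mono v" "\<And>t. 0 \<le> v t" "\<And>t. v t \<le> 1" "\<And>t. continuous (at_right t) v"
      "AE t in lborel. w t = v t"
    using right_continuous_version[OF w(1-3)] by blast
  have "AE t in leb T. u t = v t"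
    using eq w(4) v(5) unfolding AE_leb_iff by eventually_elim auto
  with v show thesis by (intro that[of v]) (auto simp: unit_monotone_def)
qed

section \<open>From a monotone function to its derivative measure\<close>

lemma regular_Borel_measure_if_finite:
  assumes M: "sets M = sets (restrict_space borel {0<..<T})" "finite_measure M"
  shows "regular_Borel_measure T M"
proof -
  have sp: "space M = {0<..<T}"
    using sets_eq_imp_space_eq[OF M(1)] by (simp add: space_restrict_space)
  have sM: "A \<in> sets M \<longleftrightarrow> A \<in> sets borel \<and> A \<subseteq> {0<..<T}" for A
    by (auto simp: M(1) sets_restrict_space_iff)
  \<comment> \<open>On the whole line, finite Borel measures are inner and outer regular. Compact
    subsets of \<open>A\<close> already lie in the open interval, and open supersets of
    \<open>A\<close> may be intersected with it, so both properties come back to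
    \<open>M\<close>.\<close>
  define M' where "M' = distr M borel (\<lambda>x. x)"
  have id: "(\<lambda>x. x) \<in> measurable M borel"
    by (subst measurable_cong_sets[OF M(1) refl]) (auto intro: measurable_restrict_space1)
  have em: "emeasure M' A = emeasure M (A \<inter> {0<..<T})" if "A \<in> sets borel" for A
    using that id by (simp add: M'_def emeasure_distr sp)
  have fin: "emeasure M' (space M') \<noteq> \<infinity>"
    using finite_measure.emeasure_finite[OF M(2)] em[of UNIV] by (simp add: M'_def)
  have M'_sets: "sets M' = sets borel" by (simp add: M'_def)
  show ?thesis
    unfolding regular_Borel_measure_def
  proof (intro conjI ballI M)
    fix A assume "A \<in> sets M"
    then have A: "A \<in> sets borel" "A \<subseteq> {0<..<T}" by (auto simp: sM)
    have emA: "emeasure M A = emeasure M' A"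
      using em[OF A(1)] A(2) by (simp add: Int_absorb2)
    also have "\<dots> = (SUP K\<in>{K. K \<subseteq> A \<and> compact K}. emeasure M' K)"
      by (rule inner_regular[OF M'_sets fin A(1)])
    also have "\<dots> = (SUP K\<in>{K. K \<subseteq> A \<and> compact K}. emeasure M K)"
    proof (rule SUP_cong[OF refl])
      fix K assume "K \<in> {K. K \<subseteq> A \<and> compact K}"
      then show "emeasure M' K = emeasure M K"
        using em[of K] A(2) by (simp add: Int_absorb2 subset_trans[of K A] borel_compact)
    qed
    finally show "emeasure M A = (SUP K\<in>{K. K \<subseteq> A \<and> compact K}. emeasure M K)" .
    show "emeasure M A = (INF U\<in>{U. A \<subseteq> U \<and> U \<subseteq> {0<..<T} \<and> open U}. emeasure M U)"
    proof (rule antisym)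
      show "emeasure M A \<le> (INF U\<in>{U. A \<subseteq> U \<and> U \<subseteq> {0<..<T} \<and> open U}. emeasure M U)"
        by (intro INF_greatest emeasure_mono) (auto simp: sM)
      have "(INF U\<in>{U. A \<subseteq> U \<and> U \<subseteq> {0<..<T} \<and> open U}. emeasure M U)
          \<le> (INF U\<in>{U. A \<subseteq> U \<and> open U}. emeasure M' U)"
      proof (rule INF_mono)
        fix U assume "U \<in> {U. A \<subseteq> U \<and> open U}"
        then show "\<exists>V\<in>{U. A \<subseteq> U \<and> U \<subseteq> {0<..<T} \<and> open U}. emeasure M V \<le> emeasure M' U"
          using A(2) em[of U] by (intro bexI[of _ "U \<inter> {0<..<T}"]) auto
      qed
      also have "\<dots> = emeasure M A"
        unfolding emA by (rule outer_regular[OF M'_sets fin A(1), symmetric])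
      finally show "(INF U\<in>{U. A \<subseteq> U \<and> U \<subseteq> {0<..<T} \<and> open U}. emeasure M U) \<le> emeasure M A" .
    qed
  qed
qed

lemma regular_Borel_measure_null:
  assumes "regular_Borel_measure T M"
  shows "regular_Borel_measure T (null_measure M)"
  using assms
  by (intro regular_Borel_measure_if_finite) (auto simp: regular_Borel_measure_def intro: finite_measureI)

text \<open>A length rather than an infimum: it lies between 0 and \<open>T\<close> even if the
  level is never crossed, it does not see null sets, so that a.e. inequalities suffice for comparing
  crossing points, and it is an integral over \<open>t\<close>.\<close>

definition switch :: "real \<Rightarrow> (real \<Rightarrow> real) \<Rightarrow> real \<Rightarrow> real"
  where "switch T z s = measure lborel {t \<in> {0<..<T}. z t \<le> s}"

lemma fmeasurable_Ioo: "{a<..<b::real} \<in> fmeasurable lborel"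
  by (cases "a \<le> b") (auto simp: fmeasurable_def)

lemma switch_level_fmeasurable:
  assumes "unit_monotone z"
  shows "{t \<in> {0<..<T}. z t \<le> s} \<in> fmeasurable lborel"
proof (rule fmeasurableI2[of "{0<..<T}"])
  have [measurable]: "z \<in> borel_measurable borel"
    using assms by (auto simp: unit_monotone_def intro: borel_measurable_mono)
  show "{t \<in> {0<..<T}. z t \<le> s} \<in> sets lborel" by measurable
qed (auto intro: fmeasurable_Ioo)

lemma mono_switch: "unit_monotone z \<Longrightarrow> mono (switch T z)"
  unfolding switch_def
  by (intro monoI measure_mono_fmeasurable switch_level_fmeasurable fmeasurableD[OF switch_level_fmeasurable])
    auto

lemma switch_bounds:
  assumes "unit_monotone z" "0 \<le> T"
  shows "0 \<le> switch T z s" "switch T z s \<le> T"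
proof -
  have "switch T z s \<le> measure lborel {0<..<T}"
    unfolding switch_def
    by (intro measure_mono_fmeasurable fmeasurableD[OF switch_level_fmeasurable] assms)
      (auto intro: fmeasurable_Ioo)
  then show "switch T z s \<le> T" using assms by simp
qed (simp add: switch_def)

text \<open>By monotonicity, a point outside a sublevel set bounds that set from above; dually, in
  \<open>less_if_switch_less\<close>, a point inside contains everything to its left. Together they
  make \<open>s < z t\<close> equivalent to \<open>switch T z s \<le> t\<close>, except possibly at
  the crossing point itself.\<close>

lemma le_if_less_switch:
  assumes z: "unit_monotone z" and t: "0 < t" "t < switch T z s"
  shows "z t \<le> s"
proof (rule ccontr)
  assume "\<not> z t \<le> s"
  moreover have "z t \<le> z x" if "t \<le> x" for x
    using z that by (auto simp: unit_monotone_def dest: monoD)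
  ultimately have "x < t" if "z x \<le> s" for x
    using that by (meson not_less order_trans)
  then have "{x \<in> {0<..<T}. z x \<le> s} \<subseteq> {0<..<t}" by auto
  then have "switch T z s \<le> measure lborel {0<..<t}"
    unfolding switch_def
    by (intro measure_mono_fmeasurable fmeasurableD[OF switch_level_fmeasurable] z)
      (auto intro: fmeasurable_Ioo)
  then show False using t by simp
qed

lemma less_if_switch_less:
  assumes z: "unit_monotone z" and t: "0 < t" "t < T" "switch T z s < t"
  shows "s < z t"
proof (rule ccontr)
  assume "\<not> s < z t"
  moreover have "z x \<le> z t" if "x \<le> t" for x
    using z that by (auto simp: unit_monotone_def dest: monoD)
  ultimately have "z x \<le> s" if "x \<le> t" for x
    using that by (meson not_less order_trans)
  then have "{0<..<t} \<subseteq> {x \<in> {0<..<T}. z x \<le> s}" using t by auto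
  then have "measure lborel {0<..<t} \<le> switch T z s"
    unfolding switch_def
    by (intro measure_mono_fmeasurable switch_level_fmeasurable z) auto
  then show False using t by simp
qed

text \<open>\<open>switch T z\<close> is the quantile function of \<open>z\<close>, so its push-forward of the Lebesgue measure on
  the levels in \<open>(0,1)\<close> is the distributional derivative; levels that \<open>z\<close> does not cross inside
  \<open>(0,T)\<close> have to be discarded.\<close>

lemma unit_monotone_has_distr_deriv:
  assumes z: "unit_monotone z" and "0 < T"
  obtains M where "has_distr_deriv T z M (null_measure M)"
proof -
  define \<sigma> where "\<sigma> = switch T z"
  have \<sigma>_meas[measurable]: "\<sigma> \<in> borel_measurable borel"
    unfolding \<sigma>_def by (intro borel_measurable_mono mono_switch z)
  have z_meas[measurable]: "z \<in> borel_measurable borel"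
    using z by (auto simp: unit_monotone_def intro: borel_measurable_mono)
  have \<sigma>_bounds: "0 \<le> \<sigma> s" "\<sigma> s \<le> T" for s
    using switch_bounds[OF z] \<open>0 < T\<close> by (auto simp: \<sigma>_def)
  have z_bounds: "0 \<le> z t" "z t \<le> 1" for t
    using z by (auto simp: unit_monotone_def)
  define S where "S = {s \<in> {0<..<1}. 0 < \<sigma> s \<and> \<sigma> s < T}"
  have S[measurable]: "S \<in> sets borel" unfolding S_def by measurable
  define M where "M = distr (restrict_space lborel S) (restrict_space borel {0<..<T}) \<sigma>"
  have \<sigma>_meas': "\<sigma> \<in> measurable (restrict_space lborel S) (restrict_space borel {0<..<T})"
    by (intro measurable_restrict_space2 measurable_restrict_space1) (auto simp: S_def space_restrict_space)
  have "finite_measure (restrict_space lborel S)"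
  proof (rule finite_measureI)
    have "emeasure lborel S \<le> emeasure lborel {0<..<1::real}"
      by (intro emeasure_mono) (auto simp: S_def)
    then show "emeasure (restrict_space lborel S) (space (restrict_space lborel S)) \<noteq> \<infinity>"
      by (auto simp: emeasure_restrict_space space_restrict_space top_unique)
  qed
  then have "finite_measure M"
    unfolding M_def by (rule finite_measure.finite_measure_distr) (rule \<sigma>_meas')
  then have reg: "regular_Borel_measure T M"
    by (intro regular_Borel_measure_if_finite) (simp_all add: M_def)
  have "(LINT t|leb T. z t * deriv \<phi> t) = - (LINT t|M. \<phi> t)" if \<phi>: "test_function T \<phi>" for \<phi>
  proof -
    obtain K where K: "K \<subseteq> {0<..<T}" "\<And>x. x \<notin> K \<Longrightarrow> \<phi> x = 0"
      using \<phi> unfolding test_function_def by blast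
    have diff: "(deriv ^^ k) \<phi> field_differentiable (at x)" for k x
      using \<phi> by (simp add: test_function_def)
    have d: "(\<phi> has_real_derivative deriv \<phi> x) (at x)" for x
      using diff[of 0 x] by (simp add: field_differentiable_derivI)
    have cont: "isCont \<phi> x" "isCont (deriv \<phi>) x" for x
      using diff[of 0 x] diff[of 1 x] by (auto intro: field_differentiable_imp_continuous_at)
    have [measurable]: "\<phi> \<in> borel_measurable borel" "deriv \<phi> \<in> borel_measurable borel"
      using cont by (auto intro!: borel_measurable_continuous_onI continuous_at_imp_continuous_on)
    have \<phi>0: "\<phi> x = 0" if "x \<le> 0 \<or> T \<le> x" for x
      using that K by (intro K(2)) (auto simp: subset_iff)
    obtain B where B: "\<And>t. t \<in> {0..T} \<Longrightarrow> \<bar>deriv \<phi> t\<bar> \<le> B"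
      using test_function_deriv_bounded[OF \<phi>] by blast
    \<comment> \<open>The layer cake formula as a double integral: integrating \<open>f\<close> over
      the levels \<open>s\<close> gives back \<open>z t * deriv \<phi> t\<close>, and integrating
      over \<open>t\<close> first gives \<open>\<phi> T - \<phi> (\<sigma> s)\<close> by the
      fundamental theorem of calculus.\<close>
    define f where "f s t = indicator {0<..<T} t * (indicator {0<..<1} s * (if s < z t then deriv \<phi> t else 0))"
      for s t :: real
    have "(LINT t|leb T. z t * deriv \<phi> t) = (LINT t|lborel. indicator {0<..<T} t * (z t * deriv \<phi> t))"
      by (simp add: integral_restrict_space integral_completion)
    also have "\<dots> = (LINT t|lborel. (LINT s|lborel. f s t))"
    proof (rule Bochner_Integration.integral_cong[OF refl])
      fix t
      have "(LINT s|lborel. f s t) = (LINT s|lborel. indicator {0<..<T} t * deriv \<phi> t * indicator {0..z t} s)"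
      proof (rule integral_cong_AE)
        show "AE s in lborel. f s t = indicator {0<..<T} t * deriv \<phi> t * indicator {0..z t} s"
          using AE_lborel_singleton[of 0] AE_lborel_singleton[of 1] AE_lborel_singleton[of "z t"]
          by eventually_elim (use z_bounds[of t] in \<open>auto simp: f_def indicator_def\<close>)
      qed (auto simp: f_def)
      also have "\<dots> = indicator {0<..<T} t * (z t * deriv \<phi> t)"
        using z_bounds[of t] by simp
      finally show "indicator {0<..<T} t * (z t * deriv \<phi> t) = (LINT s|lborel. f s t)" ..
    qed
    also have "\<dots> = (LINT s|lborel. (LINT t|lborel. f s t))"
    proof (rule lborel_pair.Fubini_integral)
      show "integrable (lborel \<Otimes>\<^sub>M lborel) (\<lambda>(s, t). f s t)"
      proof (rule integrableI_bounded_set[where A = "{0<..<1} \<times> {0<..<T}" and B = B])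
        show "emeasure (lborel \<Otimes>\<^sub>M lborel) ({0<..<1::real} \<times> {0<..<T}) < \<infinity>"
          using \<open>0 < T\<close> by (simp add: lborel.emeasure_pair_measure_Times ennreal_mult_less_top)
        show "(\<lambda>(s, t). f s t) \<in> borel_measurable (lborel \<Otimes>\<^sub>M lborel)"
          unfolding f_def by measurable
        show "AE x in lborel \<Otimes>\<^sub>M lborel. x \<in> {0<..<1} \<times> {0<..<T} \<longrightarrow> norm (case x of (s, t) \<Rightarrow> f s t) \<le> B"
          using B order_trans[OF abs_ge_zero B[of 0]] \<open>0 < T\<close> by (intro AE_I2) (auto simp: f_def)
      qed (auto simp: f_def indicator_def)
    qed
    also have "\<dots> = (LINT s|lborel. - (indicator {0<..<1} s * \<phi> (\<sigma> s)))"
    proof (rule Bochner_Integration.integral_cong[OF refl])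
      fix s :: real
      have "(LINT t|lborel. f s t) = (LINT t|lborel. indicator {0<..<1} s * (deriv \<phi> t * indicator {\<sigma> s..T} t))"
      proof (rule integral_cong_AE)
        show "AE t in lborel. f s t = indicator {0<..<1} s * (deriv \<phi> t * indicator {\<sigma> s..T} t)"
          using AE_lborel_singleton[of 0] AE_lborel_singleton[of T] AE_lborel_singleton[of "\<sigma> s"]
        proof eventually_elim
          case (elim t)
          then show ?case
            using le_if_less_switch[OF z, of t T s] less_if_switch_less[OF z, of t T s] \<sigma>_bounds[of s]
            by (auto simp: f_def indicator_def \<sigma>_def)
        qed
      qed (auto simp: f_def)
      also have "\<dots> = indicator {0<..<1} s * (LINT t|lborel. deriv \<phi> t * indicator {\<sigma> s..T} t)"
        by simp
      also have "(LINT t|lborel. deriv \<phi> t * indicator {\<sigma> s..T} t) = \<phi> T - \<phi> (\<sigma> s)"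
        using \<sigma>_bounds d cont by (intro integral_FTC_Icc_real) auto
      finally show "(LINT t|lborel. f s t) = - (indicator {0<..<1} s * \<phi> (\<sigma> s))"
        by (simp add: \<phi>0)
    qed
    also have "\<dots> = - (LINT s|lborel. indicator S s *\<^sub>R \<phi> (\<sigma> s))"
    proof -
      \<comment> \<open>Discarded levels have \<open>\<sigma> s\<close> equal to 0 or
        \<open>T\<close>, where the test function vanishes, so they contribute nothing.\<close>
      have eq: "indicator {0<..<1} s * \<phi> (\<sigma> s) = indicator S s *\<^sub>R \<phi> (\<sigma> s)" for s
        using \<phi>0[of "\<sigma> s"] by (auto simp: S_def indicator_def not_less)
      show ?thesis unfolding eq by simp
    qed
    also have "(LINT s|lborel. indicator S s *\<^sub>R \<phi> (\<sigma> s)) = (LINT s|restrict_space lborel S. \<phi> (\<sigma> s))"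
      by (subst integral_restrict_space) auto
    also have "\<dots> = (LINT t|M. \<phi> t)"
      unfolding M_def by (rule integral_distr[OF \<sigma>_meas', symmetric]) (auto intro: measurable_restrict_space1)
    finally show ?thesis .
  qed
  then have "has_distr_deriv T z M (null_measure M)"
    using reg regular_Borel_measure_null[OF reg] by (simp add: has_distr_deriv_def integral_null_measure)
  then show thesis by (rule that)
qed

section \<open>Reduction of the projection to monotone functions\<close>

lemma measure_leb: "0 \<le> T \<Longrightarrow> measure (leb T) (space (leb T)) = T"
  by (simp add: measure_restrict_space space_restrict_space)

lemma integrable_leb_AE_bounded:
  "f \<in> borel_measurable (leb T) \<Longrightarrow> AE t in leb T. \<bar>f t\<bar> \<le> B \<Longrightarrow> integrable (leb T) f"
  for f :: "real \<Rightarrow> real"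
  by (rule finite_measure.integrable_const_bound[OF finite_measure_leb]) auto

lemma integrable_powr_leb_AE_bounded:
  fixes f :: "real \<Rightarrow> real"
  assumes "f \<in> borel_measurable (leb T)" "AE t in leb T. \<bar>f t\<bar> \<le> B" "0 \<le> q"
  shows "integrable (leb T) (\<lambda>t. \<bar>f t\<bar> powr q)"
proof (rule integrable_leb_AE_bounded[of _ _ "B powr q"])
  show "(\<lambda>t. \<bar>f t\<bar> powr q) \<in> borel_measurable (leb T)"
    using assms(1) by measurable
  show "AE t in leb T. \<bar>\<bar>f t\<bar> powr q\<bar> \<le> B powr q"
    using assms(2) by eventually_elim (use assms(3) in \<open>auto intro: powr_mono2\<close>)
qed

lemma Lq_AE_bounded:
  "f \<in> borel_measurable (leb T) \<Longrightarrow> AE t in leb T. \<bar>f t\<bar> \<le> B \<Longrightarrow> 0 \<le> q \<Longrightarrow> f \<in> Lq T q"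
  by (simp add: Lq_def integrable_powr_leb_AE_bounded)

lemma Lq_vec_measurable: "c \<in> Lq_vec T q m \<Longrightarrow> i \<in> {1..m} \<Longrightarrow> c i \<in> borel_measurable (leb T)"
  by (auto simp: Lq_vec_def Lq_def)

lemma unit_monotone_measurable: "unit_monotone z \<Longrightarrow> z \<in> borel_measurable borel"
  by (auto simp: unit_monotone_def intro: borel_measurable_mono)

lemma unit_monotone_bounds: "unit_monotone z \<Longrightarrow> 0 \<le> z t" "unit_monotone z \<Longrightarrow> z t \<le> 1"
  by (auto simp: unit_monotone_def)

lemma unit_monotone_integrable: "unit_monotone z \<Longrightarrow> integrable (leb T) z"
  by (rule integrable_leb_AE_bounded[of _ _ 1])
    (auto intro!: borel_measurable_leb unit_monotone_measurable simp: unit_monotone_def)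

text \<open>Distributional derivatives are linear, and the measures of \<open>z\<close> and
  \<open>y\<close> are the two halves of the signed measure for \<open>c\<close>. This supplies the
  bounded variation of the switching components, which \<open>relaxed\<close> does not
  mention.\<close>

lemma BV_unit_monotone_diff:
  assumes z: "unit_monotone z" "unit_monotone y" and "0 < T"
    and c: "c \<in> borel_measurable (leb T)" "AE t in leb T. c t = z t - y t"
  shows "c \<in> BV T"
proof -
  obtain M where M: "has_distr_deriv T z M (null_measure M)"
    using unit_monotone_has_distr_deriv[OF z(1) \<open>0 < T\<close>] .
  obtain N where N: "has_distr_deriv T y N (null_measure N)"
    using unit_monotone_has_distr_deriv[OF z(2) \<open>0 < T\<close>] .
  have m: "z \<in> borel_measurable (leb T)" "y \<in> borel_measurable (leb T)"
    using z by (auto intro: borel_measurable_leb unit_monotone_measurable)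
  have "(LINT t|leb T. c t * deriv \<phi> t) = - ((LINT t|M. \<phi> t) - (LINT t|N. \<phi> t))"
    if \<phi>: "test_function T \<phi>" for \<phi>
  proof -
    have d: "deriv \<phi> \<in> borel_measurable (leb T)"
      by (intro borel_measurable_leb test_function_deriv_measurable[OF \<phi>])
    have int: "integrable (leb T) (\<lambda>t. v t * deriv \<phi> t)" if "unit_monotone v" for v
    proof -
      obtain B where B: "\<And>t. t \<in> {0..T} \<Longrightarrow> \<bar>deriv \<phi> t\<bar> \<le> B"
        using test_function_deriv_bounded[OF \<phi>] by blast
      have "\<bar>v t * deriv \<phi> t\<bar> \<le> B" if "t \<in> {0<..<T}" for t
      proof -
        have "\<bar>v t\<bar> * \<bar>deriv \<phi> t\<bar> \<le> 1 * B"
          using that B[of t] unit_monotone_bounds[OF \<open>unit_monotone v\<close>, of t] by (intro mult_mono) auto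
        then show ?thesis by (simp add: abs_mult)
      qed
      then show ?thesis
        using borel_measurable_times[OF borel_measurable_leb[OF unit_monotone_measurable[OF that]] d]
        by (intro integrable_leb_AE_bounded[of _ _ B] AE_I2) (auto simp: space_restrict_space)
    qed
    have "(LINT t|leb T. c t * deriv \<phi> t) = (LINT t|leb T. z t * deriv \<phi> t - y t * deriv \<phi> t)"
    proof (rule integral_cong_AE)
      show "AE t in leb T. c t * deriv \<phi> t = z t * deriv \<phi> t - y t * deriv \<phi> t"
        using c(2) by eventually_elim (simp add: left_diff_distrib)
    qed (intro borel_measurable_times borel_measurable_diff c m d)+
    also have "\<dots> = (LINT t|leb T. z t * deriv \<phi> t) - (LINT t|leb T. y t * deriv \<phi> t)"
      by (intro Bochner_Integration.integral_diff int z)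
    also have "\<dots> = - ((LINT t|M. \<phi> t) - (LINT t|N. \<phi> t))"
      using M N \<phi> by (simp add: has_distr_deriv_def integral_null_measure)
    finally show ?thesis .
  qed
  then have "has_distr_deriv T c M N"
    using M N by (simp add: has_distr_deriv_def)
  moreover have "integrable (leb T) c"
  proof (rule integrable_leb_AE_bounded[OF c(1), of 1])
    show "AE t in leb T. \<bar>c t\<bar> \<le> 1"
      using c(2)
    proof eventually_elim
      case (elim t)
      then show ?case
        using unit_monotone_bounds[OF z(1), of t] unit_monotone_bounds[OF z(2), of t] by linarith
    qed
  qed
  ultimately show ?thesis by (auto simp: BV_def)
qed

text \<open>The projection of \<^const>\<open>feasible_ext\<close> in terms of everywhere defined monotone functions instead
  of non-negative distributional derivatives.\<close>

definition relaxed :: "real \<Rightarrow> real \<Rightarrow> nat \<Rightarrow> ((nat \<Rightarrow> real) \<times> (nat \<Rightarrow> real \<Rightarrow> real)) set"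
  where "relaxed T q n =
    {(\<tau>, c). \<tau> \<in> Rvec n \<and> c \<in> Lq_vec T q (n - 1) \<and>
       (\<exists>z. (\<forall>i\<in>{1..n}. unit_monotone (z i)) \<and>
            (\<forall>i\<in>{1..n-1}. AE t in leb T. c i t = z i t - z (i + 1) t) \<and>
            (\<forall>i\<in>{1..n-1}. AE t in leb T. z (i + 1) t \<le> z i t) \<and>
            (\<forall>i\<in>{1..n}. \<tau> i = (LINT t|leb T. 1 - z i t)))}"

lemma relaxed_subset: "relaxed T q n \<subseteq> RL_space T q n"
  by (auto simp: relaxed_def RL_space_def)

text \<open>The relations between \<open>\<tau>\<close>, \<open>c\<close> and \<open>z\<close> are
  a.e. statements or integrals, so they survive the passage to monotone representatives.\<close>

lemma feasible_ext_imp_relaxed: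
  assumes "(\<tau>, c, z) \<in> feasible_ext T q n"
  shows "(\<tau>, c) \<in> relaxed T q n"
proof -
  have z: "z i \<in> borel_measurable (leb T)" "AE t in leb T. z i t \<in> {0..1}" "distr_deriv_nonneg T (z i)"
    if "i \<in> {1..n}" for i
    using assms that by (auto simp: feasible_ext_def BV01_def Lq_vec_def Lq_def)
  have "\<exists>v. unit_monotone v \<and> (AE t in leb T. z i t = v t)" if "i \<in> {1..n}" for i
    using distr_deriv_nonneg_imp_unit_monotone[OF z(3,1,2)[OF that]] by metis
  then obtain v where v: "\<And>i. i \<in> {1..n} \<Longrightarrow> unit_monotone (v i)"
      "\<And>i. i \<in> {1..n} \<Longrightarrow> AE t in leb T. z i t = v i t"
    by metis
  have "AE t in leb T. c i t = v i t - v (i + 1) t" "AE t in leb T. v (i + 1) t \<le> v i t"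
    if i: "i \<in> {1..n-1}" for i
  proof -
    have "AE t in leb T. z i t = v i t" "AE t in leb T. z (i + 1) t = v (i + 1) t"
      using i by (auto intro!: v(2))
    moreover have "AE t in leb T. c i t = z i t - z (i + 1) t"
      using assms i by (auto simp: feasible_ext_def)
    ultimately show "AE t in leb T. c i t = v i t - v (i + 1) t"
      by eventually_elim simp
    have "\<forall>i\<in>{2..n}. AE t in leb T. z i t \<le> z (i - 1) t"
      using assms by (auto simp: feasible_ext_def)
    then have "AE t in leb T. z (i + 1) t \<le> z i t"
      using i by (elim ballE[of _ _ "i + 1"]) auto
    with \<open>AE t in leb T. z i t = v i t\<close> \<open>AE t in leb T. z (i + 1) t = v (i + 1) t\<close>
    show "AE t in leb T. v (i + 1) t \<le> v i t"
      by eventually_elim simp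
  qed
  moreover have "\<tau> i = (LINT t|leb T. 1 - v i t)" if i: "i \<in> {1..n}" for i
  proof -
    have "(LINT t|leb T. 1 - z i t) = (LINT t|leb T. 1 - v i t)"
    proof (rule integral_cong_AE)
      show "AE t in leb T. 1 - z i t = 1 - v i t"
        using v(2)[OF i] by eventually_elim simp
    qed (intro borel_measurable_diff borel_measurable_const z(1)[OF i]
          borel_measurable_leb[OF unit_monotone_measurable[OF v(1)[OF i]]])+
    then show ?thesis using assms i by (auto simp: feasible_ext_def)
  qed
  ultimately show ?thesis
    using assms v(1) unfolding relaxed_def feasible_ext_def by blast
qed

lemma relaxed_imp_feasible_ext:
  assumes "(\<tau>, c) \<in> relaxed T q n" "0 < T" "0 \<le> q"
  obtains z where "z \<in> Lq_vec T q n" "(\<tau>, c, z) \<in> feasible_ext T q n"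
proof -
  from assms(1) obtain y where tc: "\<tau> \<in> Rvec n" "c \<in> Lq_vec T q (n - 1)"
    and y: "\<And>i. i \<in> {1..n} \<Longrightarrow> unit_monotone (y i)"
      "\<And>i. i \<in> {1..n-1} \<Longrightarrow> AE t in leb T. c i t = y i t - y (i + 1) t"
      "\<And>i. i \<in> {1..n-1} \<Longrightarrow> AE t in leb T. y (i + 1) t \<le> y i t"
      "\<And>i. i \<in> {1..n} \<Longrightarrow> \<tau> i = (LINT t|leb T. 1 - y i t)"
    unfolding relaxed_def by blast
  \<comment> \<open>\<open>relaxed\<close> leaves the family unconstrained outside
    \<open>{1..n}\<close>, whereas members of \<open>Lq_vec\<close> vanish there.\<close>
  define z where "z i = (if i \<in> {1..n} then y i else (\<lambda>t. 0))" for i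
  have zy: "z i = y i" if "i \<in> {1..n}" for i using that by (simp add: z_def)
  have ym: "y i \<in> borel_measurable (leb T)" if "i \<in> {1..n}" for i
    by (intro borel_measurable_leb unit_monotone_measurable y that)
  have yb: "0 \<le> y i t \<and> y i t \<le> 1" if "i \<in> {1..n}" for i t
    using unit_monotone_bounds[OF y(1)[OF that]] by simp
  have zL: "z \<in> Lq_vec T q n"
    using ym yb assms(3) by (auto simp: Lq_vec_def z_def intro!: Lq_AE_bounded[of _ _ 1])
  have yD: "distr_deriv_nonneg T (y i)" "y i \<in> BV01 T" if i: "i \<in> {1..n}" for i
  proof -
    obtain M where M: "has_distr_deriv T (y i) M (null_measure M)"
      using unit_monotone_has_distr_deriv[OF y(1)[OF i] assms(2)] .
    then show "distr_deriv_nonneg T (y i)" by (auto simp: distr_deriv_nonneg_def)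
    show "y i \<in> BV01 T"
      using M yb[OF i] unit_monotone_integrable[OF y(1)[OF i]] by (auto simp: BV01_def BV_def)
  qed
  have cD: "c i \<in> BV01 T" if i: "i \<in> {1..n-1}" for i
  proof -
    have ii: "i \<in> {1..n}" "i + 1 \<in> {1..n}" using i by auto
    have "c i \<in> BV T"
      by (rule BV_unit_monotone_diff[OF y(1)[OF ii(1)] y(1)[OF ii(2)] assms(2) Lq_vec_measurable[OF tc(2) i] y(2)[OF i]])
    moreover have "AE t in leb T. c i t \<in> {0..1}"
      using y(2)[OF i] y(3)[OF i]
    proof eventually_elim
      case (elim t)
      then show ?case using yb[OF ii(1), of t] yb[OF ii(2), of t] by auto
    qed
    ultimately show ?thesis by (simp add: BV01_def)
  qed
  have "(\<tau>, c, z) \<in> feasible_ext T q n"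
    unfolding feasible_ext_def
  proof (clarsimp simp del: atLeastAtMost_iff One_nat_def, intro conjI ballI)
    fix i assume i: "i \<in> {1..n-1}"
    then have ii: "i \<in> {1..n}" "i + 1 \<in> {1..n}" by auto
    show "AE t in leb T. c i t = z i t - z (i + 1) t"
      using y(2)[OF i] by (simp only: zy[OF ii(1)] zy[OF ii(2)])
  next
    fix i assume i: "i \<in> {2..n}"
    then have ii: "i - 1 \<in> {1..n-1}" "i - 1 + 1 = i" "i - 1 \<in> {1..n}" "i \<in> {1..n}" by auto
    show "AE t in leb T. z i t \<le> z (i - 1) t"
      using y(3)[OF ii(1)] by (simp only: zy[OF ii(3)] zy[OF ii(4)] ii(2))
  qed (use tc zL cD yD y(4) in \<open>simp_all only: zy\<close>)
  with zL show thesis by (rule that)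
qed

subsection \<open>The relaxed set is closed and convex\<close>

lemma unit_monotone_convex_comb:
  assumes "unit_monotone y" "unit_monotone z" "0 \<le> u" "0 \<le> v" "u + v = 1"
  shows "unit_monotone (\<lambda>t. u * y t + v * z t)"
proof -
  have "u * y t + v * z t \<le> u * 1 + v * 1" for t
    using assms unit_monotone_bounds by (intro add_mono mult_left_mono) auto
  then show ?thesis
    using assms unfolding unit_monotone_def mono_def
    by (auto intro!: add_mono mult_left_mono continuous_intros)
qed

lemma convex_relaxed: "0 \<le> q \<Longrightarrow> convex (relaxed T q n)"
proof (rule convexI)
  fix x x' :: "(nat \<Rightarrow> real) \<times> (nat \<Rightarrow> real \<Rightarrow> real)" and u v :: real
  assume "0 \<le> q" and x: "x \<in> relaxed T q n" "x' \<in> relaxed T q n" and uv: "0 \<le> u" "0 \<le> v" "u + v = 1"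
  obtain \<tau> c \<tau>' c' where xx: "x = (\<tau>, c)" "x' = (\<tau>', c')" by (cases x, cases x')
  obtain z where tc: "\<tau> \<in> Rvec n" "c \<in> Lq_vec T q (n - 1)"
    and z: "\<And>i. i \<in> {1..n} \<Longrightarrow> unit_monotone (z i)"
      "\<And>i. i \<in> {1..n-1} \<Longrightarrow> AE t in leb T. c i t = z i t - z (i + 1) t"
      "\<And>i. i \<in> {1..n-1} \<Longrightarrow> AE t in leb T. z (i + 1) t \<le> z i t"
      "\<And>i. i \<in> {1..n} \<Longrightarrow> \<tau> i = (LINT t|leb T. 1 - z i t)"
    using x(1) unfolding relaxed_def xx by blast
  obtain z' where tc': "\<tau>' \<in> Rvec n" "c' \<in> Lq_vec T q (n - 1)"
    and z': "\<And>i. i \<in> {1..n} \<Longrightarrow> unit_monotone (z' i)"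
      "\<And>i. i \<in> {1..n-1} \<Longrightarrow> AE t in leb T. c' i t = z' i t - z' (i + 1) t"
      "\<And>i. i \<in> {1..n-1} \<Longrightarrow> AE t in leb T. z' (i + 1) t \<le> z' i t"
      "\<And>i. i \<in> {1..n} \<Longrightarrow> \<tau>' i = (LINT t|leb T. 1 - z' i t)"
    using x(2) unfolding relaxed_def xx by blast
  define \<tau>'' where "\<tau>'' i = u * \<tau> i + v * \<tau>' i" for i
  define c'' where "c'' i t = u * c i t + v * c' i t" for i t
  define z'' where "z'' i t = u * z i t + v * z' i t" for i t
  have eq: "u *\<^sub>R x + v *\<^sub>R x' = (\<tau>'', c'')"
    by (simp add: xx scaleR_fun_def fun_eq_iff \<tau>''_def c''_def)
  have z''1: "unit_monotone (z'' i)" if "i \<in> {1..n}" for i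
    unfolding z''_def by (intro unit_monotone_convex_comb z z' uv that)
  have z''2: "AE t in leb T. c'' i t = z'' i t - z'' (i + 1) t" if "i \<in> {1..n-1}" for i
    using z(2)[OF that] z'(2)[OF that]
  proof eventually_elim
    case (elim t)
    then show ?case by (simp only: c''_def z''_def) (simp add: algebra_simps)
  qed
  have z''3: "AE t in leb T. z'' (i + 1) t \<le> z'' i t" if "i \<in> {1..n-1}" for i
    using z(3)[OF that] z'(3)[OF that]
    by eventually_elim (use uv in \<open>auto simp: z''_def intro!: add_mono mult_left_mono\<close>)
  have z''4: "\<tau>'' i = (LINT t|leb T. 1 - z'' i t)" if i: "i \<in> {1..n}" for i
  proof -
    have int: "integrable (leb T) (\<lambda>t. 1 - y t)" if "unit_monotone y" for y
      using unit_monotone_integrable[OF that]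
      by (intro Bochner_Integration.integrable_diff)
        (simp_all add: finite_measure.integrable_const finite_measure_leb)
    have "1 - z'' i t = u * (1 - z i t) + v * (1 - z' i t)" for t
      using uv by (simp add: z''_def algebra_simps)
    then show ?thesis
      using int[OF z(1)[OF i]] int[OF z'(1)[OF i]]
      by (simp add: \<tau>''_def z(4)[OF i] z'(4)[OF i])
  qed
  \<comment> \<open>Integrability of the power is read off from boundedness: a difference of two
    functions into the unit interval is at most 1 in absolute value, so Minkowski's inequality is
    not invoked.\<close>
  have "c'' i \<in> Lq T q" if i: "i \<in> {1..n-1}" for i
  proof (rule Lq_AE_bounded[OF _ _ \<open>0 \<le> q\<close>])
    show "c'' i \<in> borel_measurable (leb T)"
      unfolding c''_def using Lq_vec_measurable[OF tc(2) i] Lq_vec_measurable[OF tc'(2) i] by measurable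
    have ii: "i \<in> {1..n}" "i + 1 \<in> {1..n}" using i by auto
    show "AE t in leb T. \<bar>c'' i t\<bar> \<le> 1"
      using z''2[OF i]
    proof eventually_elim
      case (elim t)
      then show ?case
        using unit_monotone_bounds[OF z''1[OF ii(1)], of t] unit_monotone_bounds[OF z''1[OF ii(2)], of t]
        by auto
    qed
  qed
  then have "c'' \<in> Lq_vec T q (n - 1)"
    using tc tc' by (auto simp: Lq_vec_def c''_def fun_eq_iff)
  moreover have "\<tau>'' \<in> Rvec n"
    using tc tc' by (auto simp: Rvec_def \<tau>''_def)
  ultimately show "u *\<^sub>R x + v *\<^sub>R x' \<in> relaxed T q n"
    unfolding eq relaxed_def using z''1 z''2 z''3 z''4 by blast
qed

section \<open>Feasible switching functions are relaxed\<close>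

lemma unit_monotone_indicator: "unit_monotone (indicat_real {a..})"
  unfolding unit_monotone_def
proof (intro conjI allI)
  show "continuous (at_right t) (indicat_real {a..})" for t
  proof -
    have "eventually (\<lambda>s. indicat_real {a..} s = indicat_real {a..} t) (at_right t)"
      by (cases "a \<le> t") (auto simp: eventually_at_right_field indicator_def intro: exI[of _ a] exI[of _ "t + 1"])
    then show ?thesis
      by (simp add: continuous_within tendsto_eventually)
  qed
qed (auto simp: mono_def indicator_def)

lemma switching_points_mono:
  assumes "\<tau> \<in> switching_points T n" "1 \<le> i" "i \<le> j" "j \<le> n"
  shows "\<tau> i \<le> \<tau> j"
  using assms(3,4)
proof (induction j rule: dec_induct)
  case (step k)
  then have "\<tau> k \<le> \<tau> (k + 1)"
    using assms(1,2) by (auto simp: switching_points_def)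
  with step show ?case by simp
qed simp

lemma feasible_subset_relaxed: "feasible T q n \<subseteq> relaxed T q n"
proof (clarify)
  fix \<tau> c assume "(\<tau>, c) \<in> feasible T q n"
  then have \<tau>: "\<tau> \<in> switching_points T n" and c: "c \<in> Lq_vec T q (n - 1)"
    and eq: "\<And>i. i \<in> {1..n-1} \<Longrightarrow> AE t in leb T. c i t = indicat_real {\<tau> i..<\<tau> (i + 1)} t"
    by (auto simp: feasible_def)
  \<comment> \<open>The step functions jumping at the switching points: consecutive differences are
    the indicators of the half-open intervals, and \<open>1 - z i\<close> has integral
    \<open>\<tau> i\<close>.\<close>
  define z where "z i = indicat_real {\<tau> i..}" for i
  have "\<tau> i = (LINT t|leb T. 1 - z i t)" if i: "i \<in> {1..n}" for i
  proof -
    have b: "0 \<le> \<tau> i" "\<tau> i \<le> T"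
      using switching_points_mono[OF \<tau>, of 1 i] switching_points_mono[OF \<tau>, of i n] \<tau> i
      by (auto simp: switching_points_def)
    have "(LINT t|leb T. 1 - z i t) = (LINT t|leb T. indicator {0<..<\<tau> i} t)"
      by (intro Bochner_Integration.integral_cong) (auto simp: z_def indicator_def)
    also have "\<dots> = measure (leb T) ({0<..<\<tau> i} \<inter> space (leb T))"
      by simp
    also have "\<dots> = measure lebesgue {0<..<\<tau> i}"
      using b by (subst measure_restrict_space) (auto simp: space_restrict_space Int_absorb2)
    also have "\<dots> = \<tau> i"
      using b by simp
    finally show ?thesis ..
  qed
  moreover have "AE t in leb T. c i t = z i t - z (i + 1) t" "AE t in leb T. z (i + 1) t \<le> z i t"
    if i: "i \<in> {1..n-1}" for i
  proof -
    have le: "\<tau> i \<le> \<tau> (i + 1)" using \<tau> i by (auto simp: switching_points_def)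
    show "AE t in leb T. c i t = z i t - z (i + 1) t"
      using eq[OF i] by eventually_elim (use le in \<open>auto simp: z_def indicator_def\<close>)
    show "AE t in leb T. z (i + 1) t \<le> z i t"
      using le by (auto simp: z_def indicator_def)
  qed
  moreover have "unit_monotone (z i)" for i
    unfolding z_def by (rule unit_monotone_indicator)
  ultimately show "(\<tau>, c) \<in> relaxed T q n"
    using \<tau> c unfolding relaxed_def switching_points_def by blast
qed

section \<open>Compactness and closedness\<close>

lemma Helly_selection_unit_monotone:
  assumes z: "\<And>k. unit_monotone (z k)"
  obtains r F where "strict_mono (r :: nat \<Rightarrow> nat)" "unit_monotone F"
    "AE t in lborel. (\<lambda>k. z (r k) t) \<longlonglongrightarrow> F t"
proof -
  have "continuous (at_right t) (z k)" "mono (z k)" "\<bar>z k t\<bar> \<le> 1" for k t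
    using z[of k] by (auto simp: unit_monotone_def)
  from Helly_selection[of z 1, OF this] obtain r F where r: "strict_mono (r :: nat \<Rightarrow> nat)"
    and F: "\<And>x. continuous (at_right x) F" "mono F" "\<And>x. \<bar>F x\<bar> \<le> 1"
      "\<And>x. isCont F x \<Longrightarrow> (\<lambda>k. z (r k) x) \<longlonglongrightarrow> F x"
    by metis
  \<comment> \<open>Selection preserves only the bound on the absolute value. Clamping at 0 restores
    the unit range everywhere and changes nothing at continuity points of \<open>F\<close>, where
    \<open>F\<close> is a limit of non-negative numbers.\<close>
  define G where "G x = max 0 (F x)" for x
  have "unit_monotone G"
    unfolding unit_monotone_def
  proof (intro conjI allI)
    show "mono G" using F(2) by (auto simp: mono_def G_def intro: max.coboundedI2)
    show "G t \<in> {0..1}" for t using F(3)[of t] by (auto simp: G_def)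
    show "continuous (at_right t) G" for t
      unfolding G_def using F(1)[of t] by (intro continuous_max continuous_const)
  qed
  moreover have "(\<lambda>k. z (r k) x) \<longlonglongrightarrow> G x" if "isCont F x" for x
  proof -
    have "0 \<le> F x"
      using unit_monotone_bounds(1)[OF z] by (intro LIMSEQ_le_const[OF F(4)[OF that]]) auto
    then show ?thesis using F(4)[OF that] by (simp add: G_def)
  qed
  then have "AE t in lborel. (\<lambda>k. z (r k) t) \<longlonglongrightarrow> G t"
    by (intro AE_I'[of "{t. \<not> isCont F t}"] countable_imp_null_set_lborel mono_ctble_discont F(2)) auto
  ultimately show thesis using r by (intro that)
qed

text \<open>For finitely many indices successive extraction suffices: a.e. limits obtained earlier
  persist along every further subsequence.\<close>

lemma Helly_selection_unit_monotone_family: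
  assumes "finite I" "\<And>k i. i \<in> I \<Longrightarrow> unit_monotone (z k i)"
  shows "\<exists>r F. strict_mono (r :: nat \<Rightarrow> nat) \<and> (\<forall>i\<in>I. unit_monotone (F i)) \<and>
           (\<forall>i\<in>I. AE t in lborel. (\<lambda>k. z (r k) i t) \<longlonglongrightarrow> F i t)"
  using assms
proof (induction I rule: finite_induct)
  case empty
  show ?case by (auto intro!: exI[of _ id] simp: strict_mono_def)
next
  case (insert j I)
  have "\<exists>r F. strict_mono (r :: nat \<Rightarrow> nat) \<and> (\<forall>i\<in>I. unit_monotone (F i)) \<and>
           (\<forall>i\<in>I. AE t in lborel. (\<lambda>k. z (r k) i t) \<longlonglongrightarrow> F i t)"
    by (rule insert.IH) (rule insert.prems, simp)
  then obtain r F where r: "strict_mono (r :: nat \<Rightarrow> nat)" and F: "\<And>i. i \<in> I \<Longrightarrow> unit_monotone (F i)"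
    "\<And>i. i \<in> I \<Longrightarrow> AE t in lborel. (\<lambda>k. z (r k) i t) \<longlonglongrightarrow> F i t"
    by blast
  obtain s G where s: "strict_mono (s :: nat \<Rightarrow> nat)" and G: "unit_monotone G"
    "AE t in lborel. (\<lambda>k. z (r (s k)) j t) \<longlonglongrightarrow> G t"
    using Helly_selection_unit_monotone[of "\<lambda>k. z (r k) j"] insert.prems by blast
  have "AE t in lborel. (\<lambda>k. z (r (s k)) i t) \<longlonglongrightarrow> F i t" if "i \<in> I" for i
    using F(2)[OF that] by eventually_elim (use LIMSEQ_subseq_LIMSEQ[OF _ s] in \<open>auto simp: o_def\<close>)
  moreover have "strict_mono (\<lambda>k. r (s k))"
    using strict_mono_o[OF r s] by (simp add: o_def)
  ultimately show ?case
    using F(1) G insert.hyps by (intro exI[of _ "\<lambda>k. r (s k)"] exI[of _ "F(j := G)"]) auto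
qed

lemma Lq_norm_nonneg: "0 \<le> Lq_norm T q f"
  by (simp add: Lq_norm_def)

lemma RL_norm_component:
  "i \<in> {1..n} \<Longrightarrow> \<bar>fst p i\<bar> \<le> RL_norm T q n p"
  "i \<in> {1..n-1} \<Longrightarrow> Lq_norm T q (snd p i) \<le> RL_norm T q n p"
proof -
  have s: "0 \<le> (\<Sum>i=1..n-1. Lq_norm T q (snd p i))"
    by (intro sum_nonneg Lq_norm_nonneg)
  show "\<bar>fst p i\<bar> \<le> RL_norm T q n p" if "i \<in> {1..n}"
    using member_le_L2_set[of "{1..n}" i "\<lambda>i. \<bar>fst p i\<bar>"] that s
    by (simp add: RL_norm_def L2_set_def)
  have "Lq_norm T q (snd p i) \<le> (\<Sum>i=1..n-1. Lq_norm T q (snd p i))" if "i \<in> {1..n-1}"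
    using that by (intro member_le_sum Lq_norm_nonneg) auto
  then show "Lq_norm T q (snd p i) \<le> RL_norm T q n p" if "i \<in> {1..n-1}"
    using that L2_set_nonneg[of "fst p" "{1..n}"] by (simp add: RL_norm_def add_increasing)
qed

text \<open>Truncating the integrands at \<open>1\<close> makes dominated convergence applicable.\<close>

lemma Lq_norm_tendsto_0_AE_unique:
  assumes "q > 0" and f: "\<And>k. f k \<in> borel_measurable (leb T)" "\<And>k. AE t in leb T. \<bar>f k t\<bar> \<le> B"
    and g: "g \<in> Lq T q" and h: "h \<in> borel_measurable (leb T)"
    and lim: "(\<lambda>k. Lq_norm T q (f k - g)) \<longlonglongrightarrow> 0"
    and ae: "AE t in leb T. (\<lambda>k. f k t) \<longlonglongrightarrow> h t"
  shows "AE t in leb T. g t = h t"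
proof -
  have [measurable]: "g \<in> borel_measurable (leb T)" and g_int: "integrable (leb T) (\<lambda>t. \<bar>g t\<bar> powr q)"
    using g by (auto simp: Lq_def)
  note [measurable] = f(1) h
  define B' where "B' = max B 0"
  have int: "integrable (leb T) (\<lambda>t. \<bar>f k t - g t\<bar> powr q)" for k
  proof (rule Bochner_Integration.integrable_bound)
    show "integrable (leb T) (\<lambda>t. (2 * B') powr q + 2 powr q * \<bar>g t\<bar> powr q)"
      using g_int by (intro Bochner_Integration.integrable_add integrable_mult_right)
        (simp_all add: finite_measure.integrable_const finite_measure_leb)
    show "AE t in leb T. norm (\<bar>f k t - g t\<bar> powr q) \<le> norm ((2 * B') powr q + 2 powr q * \<bar>g t\<bar> powr q)"
      using f(2)[of k]
    proof eventually_elim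
      case (elim t)
      \<comment> \<open>A sum is at most twice its larger term; with this form, monotonicity of the
        power is enough to obtain an integrable majorant.\<close>
      have "\<bar>f k t - g t\<bar> \<le> max (2 * B') (2 * \<bar>g t\<bar>)"
        using elim by (auto simp: B'_def)
      then have "\<bar>f k t - g t\<bar> powr q \<le> max (2 * B') (2 * \<bar>g t\<bar>) powr q"
        using \<open>q > 0\<close> by (intro powr_mono2) auto
      also have "\<dots> \<le> (2 * B') powr q + (2 * \<bar>g t\<bar>) powr q"
        by (auto simp: max_def)
      finally show ?case by (simp add: powr_mult)
    qed
  qed measurable
  have lim_int: "(\<lambda>k. LINT t|leb T. \<bar>f k t - g t\<bar> powr q) \<longlonglongrightarrow> 0"
  proof -
    have "(\<lambda>k. Lq_norm T q (f k - g) powr q) \<longlonglongrightarrow> 0"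
      using lim \<open>q > 0\<close> by (intro tendsto_zero_powrI[OF _ tendsto_const]) (auto simp: Lq_norm_nonneg)
    moreover have "Lq_norm T q (f k - g) powr q = (LINT t|leb T. \<bar>f k t - g t\<bar> powr q)" for k
      using \<open>q > 0\<close> by (simp add: Lq_norm_def powr_powr Bochner_Integration.integral_nonneg)
    ultimately show ?thesis by simp
  qed
  have bint: "integrable (leb T) (\<lambda>t. min 1 (\<bar>y t\<bar> powr q))"
    if [measurable]: "y \<in> borel_measurable (leb T)" for y :: "real \<Rightarrow> real"
    by (rule integrable_leb_AE_bounded[of _ _ 1]) auto
  have min_le: "(LINT t|leb T. min 1 (\<bar>f k t - g t\<bar> powr q)) \<le> (LINT t|leb T. \<bar>f k t - g t\<bar> powr q)" for k
    using bint[of "\<lambda>t. f k t - g t"] by (intro integral_mono int) auto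
  have "(\<lambda>k. LINT t|leb T. min 1 (\<bar>f k t - g t\<bar> powr q)) \<longlonglongrightarrow> 0"
  proof (rule tendsto_sandwich[OF _ _ tendsto_const lim_int])
    show "eventually (\<lambda>k. 0 \<le> (LINT t|leb T. min 1 (\<bar>f k t - g t\<bar> powr q))) sequentially"
      by (intro always_eventually allI Bochner_Integration.integral_nonneg) simp
    show "eventually (\<lambda>k. (LINT t|leb T. min 1 (\<bar>f k t - g t\<bar> powr q)) \<le> (LINT t|leb T. \<bar>f k t - g t\<bar> powr q)) sequentially"
      by (intro always_eventually allI min_le)
  qed
  moreover have "(\<lambda>k. LINT t|leb T. min 1 (\<bar>f k t - g t\<bar> powr q)) \<longlonglongrightarrow> (LINT t|leb T. min 1 (\<bar>h t - g t\<bar> powr q))"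
  proof (rule integral_dominated_convergence[where w = "\<lambda>_. 1"])
    show "AE t in leb T. (\<lambda>k. min 1 (\<bar>f k t - g t\<bar> powr q)) \<longlonglongrightarrow> min 1 (\<bar>h t - g t\<bar> powr q)"
      using ae by eventually_elim (use \<open>q > 0\<close> in \<open>intro tendsto_min tendsto_powr2 tendsto_intros; auto\<close>)
  qed (auto simp: finite_measure.integrable_const finite_measure_leb)
  ultimately have "(LINT t|leb T. min 1 (\<bar>h t - g t\<bar> powr q)) = 0"
    using LIMSEQ_unique by blast
  then have "AE t in leb T. min 1 (\<bar>h t - g t\<bar> powr q) = 0"
    using bint[of "\<lambda>t. h t - g t"] by (subst (asm) integral_nonneg_eq_0_iff_AE) auto
  then show ?thesis
    by eventually_elim (auto simp: min_def split: if_splits)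
qed

text \<open>Helly selection produces the missing limit of the auxiliary functions. Order relations
  pass to a.e. limits and the formula for \<open>\<tau>\<close> by dominated convergence. The
  component \<open>c i\<close> is a limit in norm, \<open>F i - F (i + 1)\<close> one almost
  everywhere; the two kinds of limit must coincide.\<close>

lemma relaxed_sequentially_closed:
  assumes "q > 0" and y: "\<And>k. y k \<in> relaxed T q n" and x: "x \<in> RL_space T q n"
    and lim: "(\<lambda>k. RL_norm T q n (y k - x)) \<longlonglongrightarrow> 0"
  shows "x \<in> relaxed T q n"
proof -
  obtain \<tau> c where x_eq: "x = (\<tau>, c)" by (cases x)
  define P where "P k z \<longleftrightarrow> (\<forall>i\<in>{1..n}. unit_monotone (z i)) \<and>
            (\<forall>i\<in>{1..n-1}. AE t in leb T. snd (y k) i t = z i t - z (i + 1) t) \<and>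
            (\<forall>i\<in>{1..n-1}. AE t in leb T. z (i + 1) t \<le> z i t) \<and>
            (\<forall>i\<in>{1..n}. fst (y k) i = (LINT t|leb T. 1 - z i t))" for k z
  have "\<exists>z. P k z" for k
  proof -
    have "(fst (y k), snd (y k)) \<in> relaxed T q n" using y[of k] by simp
    then show ?thesis unfolding relaxed_def P_def by blast
  qed
  then obtain z where "\<And>k. P k (z k)" by metis
  then have z: "\<And>k i. i \<in> {1..n} \<Longrightarrow> unit_monotone (z k i)"
      "\<And>k i. i \<in> {1..n-1} \<Longrightarrow> AE t in leb T. snd (y k) i t = z k i t - z k (i + 1) t"
      "\<And>k i. i \<in> {1..n-1} \<Longrightarrow> AE t in leb T. z k (i + 1) t \<le> z k i t"
      "\<And>k i. i \<in> {1..n} \<Longrightarrow> fst (y k) i = (LINT t|leb T. 1 - z k i t)"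
    unfolding P_def by blast+
  have "\<exists>r F. strict_mono (r :: nat \<Rightarrow> nat) \<and> (\<forall>i\<in>{1..n}. unit_monotone (F i)) \<and>
           (\<forall>i\<in>{1..n}. AE t in lborel. (\<lambda>k. z (r k) i t) \<longlonglongrightarrow> F i t)"
    by (rule Helly_selection_unit_monotone_family[OF finite_atLeastAtMost z(1)])
  then obtain r F where r: "strict_mono (r :: nat \<Rightarrow> nat)" and F: "\<And>i. i \<in> {1..n} \<Longrightarrow> unit_monotone (F i)"
      "\<And>i. i \<in> {1..n} \<Longrightarrow> AE t in lborel. (\<lambda>k. z (r k) i t) \<longlonglongrightarrow> F i t"
    by blast
  have conv: "AE t in leb T. (\<lambda>k. z (r k) i t) \<longlonglongrightarrow> F i t" if "i \<in> {1..n}" for i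
    unfolding AE_leb_iff using F(2)[OF that] by eventually_elim simp
  have lim_r: "(\<lambda>k. RL_norm T q n (y (r k) - x)) \<longlonglongrightarrow> 0"
    using LIMSEQ_subseq_LIMSEQ[OF lim r] by (simp add: o_def)
  have zm: "z k i \<in> borel_measurable (leb T)" "F i \<in> borel_measurable (leb T)" if "i \<in> {1..n}" for k i
    by (intro borel_measurable_leb unit_monotone_measurable z(1) F(1) that)+
  have "AE t in leb T. F (i + 1) t \<le> F i t" if i: "i \<in> {1..n-1}" for i
  proof -
    have ii: "i \<in> {1..n}" "i + 1 \<in> {1..n}" using i by auto
    have "AE t in leb T. \<forall>k. z (r k) (i + 1) t \<le> z (r k) i t"
      using z(3)[OF i] by (subst AE_all_countable) blast
    with conv[OF ii(1)] conv[OF ii(2)] show ?thesis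
      by eventually_elim (auto intro: LIMSEQ_le)
  qed
  moreover have "AE t in leb T. c i t = F i t - F (i + 1) t" if i: "i \<in> {1..n-1}" for i
  proof (rule Lq_norm_tendsto_0_AE_unique[where f = "\<lambda>k t. z (r k) i t - z (r k) (i + 1) t" and B = 1, OF \<open>q > 0\<close>])
    have ii: "i \<in> {1..n}" "i + 1 \<in> {1..n}" using i by auto
    show "(\<lambda>t. z (r k) i t - z (r k) (i + 1) t) \<in> borel_measurable (leb T)"
         "(\<lambda>t. F i t - F (i + 1) t) \<in> borel_measurable (leb T)" for k
      by (intro borel_measurable_diff zm ii)+
    show "AE t in leb T. \<bar>z (r k) i t - z (r k) (i + 1) t\<bar> \<le> 1" for k
    proof (rule AE_I2)
      fix t
      show "\<bar>z (r k) i t - z (r k) (i + 1) t\<bar> \<le> 1"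
        using unit_monotone_bounds[OF z(1)[OF ii(1)], of "r k" t]
          unit_monotone_bounds[OF z(1)[OF ii(2)], of "r k" t] by linarith
    qed
    show "c i \<in> Lq T q" using x i by (auto simp: x_eq RL_space_def Lq_vec_def)
    show "AE t in leb T. (\<lambda>k. z (r k) i t - z (r k) (i + 1) t) \<longlonglongrightarrow> F i t - F (i + 1) t"
      using conv[OF ii(1)] conv[OF ii(2)] by eventually_elim (rule tendsto_diff)
    have c_meas: "c i \<in> borel_measurable (leb T)"
      using x i by (auto simp: x_eq RL_space_def intro: Lq_vec_measurable)
    \<comment> \<open>The differences of the monotone functions, which are bounded and converge
      a.e., replace the given components; the norm cannot tell them apart.\<close>
    have eq: "Lq_norm T q ((\<lambda>t. z (r k) i t - z (r k) (i + 1) t) - c i) = Lq_norm T q (snd (y (r k) - x) i)" for k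
    proof -
      have ym: "snd (y (r k)) i \<in> borel_measurable (leb T)"
        using y[of "r k"] relaxed_subset[of T q n] i
        by (cases "y (r k)") (auto simp: RL_space_def intro: Lq_vec_measurable)
      have zm': "(\<lambda>t. z (r k) i t - z (r k) (i + 1) t) \<in> borel_measurable (leb T)"
        by (intro borel_measurable_diff zm ii)
      have "(LINT t|leb T. \<bar>z (r k) i t - z (r k) (i + 1) t - c i t\<bar> powr q) =
            (LINT t|leb T. \<bar>snd (y (r k)) i t - c i t\<bar> powr q)"
      proof (rule integral_cong_AE)
        show "AE t in leb T. \<bar>z (r k) i t - z (r k) (i + 1) t - c i t\<bar> powr q = \<bar>snd (y (r k)) i t - c i t\<bar> powr q"
          using z(2)[OF i, of "r k"] by eventually_elim simp
      qed (use ym zm' c_meas in measurable)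
      then show ?thesis by (simp add: Lq_norm_def x_eq)
    qed
    show "(\<lambda>k. Lq_norm T q ((\<lambda>t. z (r k) i t - z (r k) (i + 1) t) - c i)) \<longlonglongrightarrow> 0"
      unfolding eq
    proof (rule tendsto_sandwich[OF _ _ tendsto_const lim_r])
      show "eventually (\<lambda>k. 0 \<le> Lq_norm T q (snd (y (r k) - x) i)) sequentially"
        by (simp add: Lq_norm_nonneg)
      show "eventually (\<lambda>k. Lq_norm T q (snd (y (r k) - x) i) \<le> RL_norm T q n (y (r k) - x)) sequentially"
        by (intro always_eventually allI RL_norm_component(2)[OF i])
    qed
  qed
  moreover have "\<tau> i = (LINT t|leb T. 1 - F i t)" if i: "i \<in> {1..n}" for i
  proof -
    have "(\<lambda>k. fst (y (r k) - x) i) \<longlonglongrightarrow> 0"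
      by (rule Lim_null_comparison[OF _ lim_r])
        (unfold real_norm_def, intro always_eventually allI RL_norm_component(1)[OF i])
    then have "(\<lambda>k. fst (y (r k)) i - \<tau> i + \<tau> i) \<longlonglongrightarrow> 0 + \<tau> i"
      by (intro tendsto_add tendsto_const) (simp add: x_eq)
    then have "(\<lambda>k. LINT t|leb T. 1 - z (r k) i t) \<longlonglongrightarrow> \<tau> i"
      by (simp add: z(4)[OF i])
    moreover have "(\<lambda>k. LINT t|leb T. 1 - z (r k) i t) \<longlonglongrightarrow> (LINT t|leb T. 1 - F i t)"
    proof (rule integral_dominated_convergence[where w = "\<lambda>_. 1"])
      show "AE t in leb T. (\<lambda>k. 1 - z (r k) i t) \<longlonglongrightarrow> 1 - F i t"
        using conv[OF i] by eventually_elim (intro tendsto_intros)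
      show "AE t in leb T. norm (1 - z (r k) i t) \<le> 1" for k
        using unit_monotone_bounds[OF z(1)[OF i]] by (intro AE_I2) auto
    qed (use zm[OF i] in \<open>auto simp: finite_measure.integrable_const finite_measure_leb\<close>)
    ultimately show ?thesis by (rule LIMSEQ_unique)
  qed
  ultimately show ?thesis
    using F(1) x unfolding relaxed_def x_eq RL_space_def by blast
qed

text \<open>Since open sets are described by balls of one seminorm, sequences decide closedness: a
  point of the complement without a ball in it is a limit of relaxed points at distance below
  \<open>1 / Suc k\<close>.\<close>

lemma closedin_relaxed:
  assumes "q > 0"
  shows "closedin (RL_topology T q n) (relaxed T q n)"
  unfolding closedin_def topspace_RL_topology openin_RL_topology
proof
  show "RL_open T q n (RL_space T q n - relaxed T q n)"
    unfolding RL_open_def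
  proof (intro conjI ballI)
    fix x assume x: "x \<in> RL_space T q n - relaxed T q n"
    show "\<exists>e>0. \<forall>y\<in>RL_space T q n. RL_norm T q n (y - x) < e \<longrightarrow> y \<in> RL_space T q n - relaxed T q n"
    proof (rule ccontr)
      assume "\<not> ?thesis"
      then have "\<exists>y. y \<in> relaxed T q n \<and> RL_norm T q n (y - x) < 1 / Suc k" for k
        by (metis DiffI of_nat_0_less_iff zero_less_Suc zero_less_divide_1_iff)
      then obtain y where y: "\<And>k. y k \<in> relaxed T q n" "\<And>k. RL_norm T q n (y k - x) < 1 / Suc k"
        by metis
      have "(\<lambda>k. RL_norm T q n (y k - x)) \<longlonglongrightarrow> 0"
      proof (rule tendsto_sandwich[OF _ _ tendsto_const LIMSEQ_Suc[OF lim_1_over_n]])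
        show "eventually (\<lambda>k. 0 \<le> RL_norm T q n (y k - x)) sequentially"
          by (simp add: RL_norm_def sum_nonneg Lq_norm_nonneg)
        show "eventually (\<lambda>k. RL_norm T q n (y k - x) \<le> 1 / real (Suc k)) sequentially"
          using y(2) by (intro always_eventually allI less_imp_le)
      qed
      then have "x \<in> relaxed T q n"
        using relaxed_sequentially_closed[where y = y and x = x, OF assms y(1)] x by blast
      with x show False by simp
    qed
  qed auto
qed (rule relaxed_subset)

subsection \<open>Approximation by convex combinations of switching functions\<close>

text \<open>Counting the half-integers 1/2, 3/2, ... below \<open>x\<close> rounds \<open>x\<close>
  to a nearest integer.\<close>

lemma sum_of_bool_half_integers_approx:
  fixes x :: real
  assumes "0 \<le> x" "x \<le> N"
  shows "\<bar>(\<Sum>k<N. of_bool (real k + 1 / 2 < x)) - x\<bar> \<le> 1 / 2"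
  using assms
proof (induction N)
  case (Suc N)
  show ?case
  proof (cases "x \<le> N")
    case True
    with Suc show ?thesis by simp
  next
    case False
    have "(\<Sum>k<N. of_bool (real k + 1 / 2 < x)) = (\<Sum>k<N. 1 :: real)"
    proof (rule sum.cong[OF refl])
      fix k assume "k \<in> {..<N}"
      then have "real k + 1 \<le> real N" by simp
      then show "of_bool (real k + 1 / 2 < x) = (1 :: real)" using False by simp
    qed
    then show ?thesis using False Suc.prems by (auto simp: of_bool_def)
  qed
qed simp

text \<open>The midpoint rule for writing \<open>v\<close> as the integral of the indicator of
  \<open>s < v\<close> over the levels \<open>s\<close>; scaling by \<open>N\<close> reduces it to
  rounding. The argument yields half of the stated bound.\<close>

lemma layer_cake_approx:
  fixes v :: real
  assumes "0 \<le> v" "v \<le> 1" "0 < N"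
  shows "\<bar>(\<Sum>k<N. of_bool ((real k + 1 / 2) / real N < v)) / real N - v\<bar> \<le> 1 / real N"
proof -
  define S :: real where "S = (\<Sum>k<N. of_bool ((real k + 1 / 2) / real N < v))"
  have "S = (\<Sum>k<N. of_bool (real k + 1 / 2 < real N * v))"
    unfolding S_def using assms by (intro sum.cong) (auto simp: divide_less_eq mult.commute)
  then have "\<bar>S - real N * v\<bar> \<le> 1 / 2"
    using sum_of_bool_half_integers_approx[of "real N * v" N] assms by (simp add: mult_left_le)
  then have "\<bar>S - real N * v\<bar> / real N \<le> 1 / real N"
    by (intro divide_right_mono) auto
  also have "\<bar>S - real N * v\<bar> / real N = \<bar>S / real N - v\<bar>"
    using assms by (simp add: abs_if field_simps)
  finally show ?thesis by (simp add: S_def)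
qed

section \<open>Crossing points of ordered monotone functions\<close>

lemma switch_eq_integral:
  assumes "unit_monotone z"
  shows "switch T z s = (LINT t|leb T. of_bool (z t \<le> s))"
proof -
  have m: "{t \<in> {0<..<T}. z t \<le> s} \<in> sets borel"
    using fmeasurableD[OF switch_level_fmeasurable[OF assms, of T s]] by simp
  have "(LINT t|leb T. of_bool (z t \<le> s)) = (LINT t|leb T. indicator {t \<in> {0<..<T}. z t \<le> s} t)"
    by (intro Bochner_Integration.integral_cong) (auto simp: space_restrict_space indicator_def)
  also have "\<dots> = measure (leb T) ({t \<in> {0<..<T}. z t \<le> s} \<inter> space (leb T))"
    by simp
  also have "\<dots> = measure lebesgue {t \<in> {0<..<T}. z t \<le> s}"
    by (subst measure_restrict_space) (auto simp: space_restrict_space intro!: arg_cong[where f = "measure lebesgue"])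
  also have "\<dots> = switch T z s"
    using m by (simp add: switch_def measure_completion)
  finally show ?thesis ..
qed

text \<open>A smaller function has larger sublevel sets. Along the decreasing chain of the
  \<open>z i\<close>, this orders the crossing points at every level.\<close>

lemma switch_antimono:
  assumes "unit_monotone y" "unit_monotone z" "AE t in leb T. y t \<le> z t"
  shows "switch T z s \<le> switch T y s"
proof -
  have i: "integrable (leb T) (\<lambda>t. of_bool (v t \<le> s) :: real)" if "unit_monotone v" for v
  proof (rule integrable_leb_AE_bounded[of _ _ 1])
    have [measurable]: "v \<in> borel_measurable borel" by (rule unit_monotone_measurable[OF that])
    show "(\<lambda>t. of_bool (v t \<le> s) :: real) \<in> borel_measurable (leb T)"
      by (intro borel_measurable_leb) measurable
  qed auto
  show ?thesis
    unfolding switch_eq_integral[OF assms(1)] switch_eq_integral[OF assms(2)]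
  proof (rule integral_mono_AE[OF i[OF assms(2)] i[OF assms(1)]])
    show "AE t in leb T. of_bool (z t \<le> s) \<le> (of_bool (y t \<le> s) :: real)"
      using assms(3) by eventually_elim auto
  qed
qed

text \<open>At a fixed level, a difference of two ordered monotone functions becomes the indicator
  of a single interval. Only the two crossing points can be exceptional.\<close>

lemma AE_indicator_switch:
  assumes z: "unit_monotone z" "unit_monotone y" "AE t in leb T. y t \<le> z t"
  shows "AE t in leb T. indicat_real {switch T z s..<switch T y s} t = of_bool (s < z t) - of_bool (s < y t)"
  unfolding AE_leb_iff
  using AE_lborel_singleton[of "switch T z s"] AE_lborel_singleton[of "switch T y s"]
proof eventually_elim
  case (elim t)
  show ?case
  proof
    assume t: "t \<in> {0<..<T}"
    have "s < v t \<longleftrightarrow> switch T v s \<le> t" if "unit_monotone v" "t \<noteq> switch T v s" for v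
      using le_if_less_switch[OF that(1), of t T s] less_if_switch_less[OF that(1), of t T s] t that(2)
      by (cases "t < switch T v s") auto
    then show "indicat_real {switch T z s..<switch T y s} t = of_bool (s < z t) - of_bool (s < y t)"
      using elim switch_antimono[OF z(2,1,3), of s] z by (auto simp: indicator_def)
  qed
qed

lemma Lq_norm_AE_le:
  assumes "f \<in> borel_measurable (leb T)" "AE t in leb T. \<bar>f t\<bar> \<le> B" "0 \<le> B" "0 < q" "0 \<le> T"
  shows "Lq_norm T q f \<le> B * T powr (1 / q)"
proof -
  have "(LINT t|leb T. \<bar>f t\<bar> powr q) \<le> (LINT t|leb T. B powr q)"
  proof (rule integral_mono_AE)
    show "integrable (leb T) (\<lambda>t. \<bar>f t\<bar> powr q)"
      using assms by (intro integrable_powr_leb_AE_bounded) auto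
    show "AE t in leb T. \<bar>f t\<bar> powr q \<le> B powr q"
      using assms(2) by eventually_elim (use assms(4) in \<open>auto intro: powr_mono2\<close>)
  qed (simp add: finite_measure.integrable_const finite_measure_leb)
  also have "\<dots> = T * B powr q"
    using measure_leb[OF assms(5)] by simp
  finally have "Lq_norm T q f \<le> (T * B powr q) powr (1 / q)"
    unfolding Lq_norm_def using assms(4) by (intro powr_mono2 Bochner_Integration.integral_nonneg) auto
  also have "\<dots> = B * T powr (1 / q)"
    using assms by (simp add: powr_mult powr_powr)
  finally show ?thesis .
qed

lemma sum_fun_apply: "(\<Sum>k\<in>A. f k) x = (\<Sum>k\<in>A. f k x)"
  by (induction A rule: infinite_finite_induct) (auto simp: zero_fun_def)

text \<open>Each of the \<open>n\<close> numbers is off by at most \<open>T / N\<close>. Each of the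
  \<open>n - 1\<close> functions is off by at most \<open>2 / N\<close> almost everywhere, which
  over an interval of length \<open>T\<close> costs the factor \<open>T powr (1 / q)\<close> in
  norm.\<close>

lemma relaxed_approximation:
  assumes x: "x \<in> relaxed T q n" and "0 < T" "0 < q" "0 < N"
  obtains y where "y \<in> convex hull (feasible T q n)"
    "RL_norm T q n (y - x) \<le> (real n * T + real (n - 1) * (2 * T powr (1 / q))) / real N"
proof -
  obtain \<tau> c where x_eq: "x = (\<tau>, c)" by (cases x)
  obtain z where tc: "\<tau> \<in> Rvec n" "c \<in> Lq_vec T q (n - 1)"
    and z: "\<And>i. i \<in> {1..n} \<Longrightarrow> unit_monotone (z i)"
      "\<And>i. i \<in> {1..n-1} \<Longrightarrow> AE t in leb T. c i t = z i t - z (i + 1) t"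
      "\<And>i. i \<in> {1..n-1} \<Longrightarrow> AE t in leb T. z (i + 1) t \<le> z i t"
      "\<And>i. i \<in> {1..n} \<Longrightarrow> \<tau> i = (LINT t|leb T. 1 - z i t)"
    using x unfolding relaxed_def x_eq by blast
  \<comment> \<open>The midpoints of \<open>N\<close> equal cells of the unit interval, shared by
    all indices \<open>i\<close>.\<close>
  define s where "s k = (real k + 1 / 2) / real N" for k
  define \<sigma> where "\<sigma> k i = (if i \<in> {1..n} then switch T (z i) (s k) else 0)" for k i
  define d where "d k i = (if i \<in> {1..n-1} then indicat_real {\<sigma> k i..<\<sigma> k (i + 1)} else (\<lambda>t. 0))" for k i
  have p: "(\<sigma> k, d k) \<in> feasible T q n" for k
  proof -
    have le: "\<sigma> k i \<le> \<sigma> k (i + 1)" if "i \<in> {1..n-1}" for i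
      using that z by (auto simp: \<sigma>_def intro!: switch_antimono)
    have "\<sigma> k \<in> switching_points T n"
      using le switch_bounds[OF z(1), of _ T] \<open>0 < T\<close>
      by (auto simp: switching_points_def Rvec_def \<sigma>_def)
    moreover have "d k \<in> Lq_vec T q (n - 1)"
      using \<open>0 < q\<close> by (auto simp: Lq_vec_def d_def intro!: Lq_AE_bounded[of _ _ 1] borel_measurable_leb)
    ultimately show ?thesis by (auto simp: feasible_def d_def)
  qed
  define y where "y = (\<Sum>k<N. (1 / real N) *\<^sub>R (\<sigma> k, d k))"
  have y_hull: "y \<in> convex hull (feasible T q n)"
    unfolding y_def using \<open>0 < N\<close> by (intro convex_sum convex_convex_hull hull_inc p) auto
  have fst_y: "fst y i = (\<Sum>k<N. \<sigma> k i) / real N" for i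
    by (simp add: y_def fst_sum sum_fun_apply scaleR_fun_def sum_divide_distrib)
  have snd_y: "snd y i t = (\<Sum>k<N. d k i t) / real N" for i t
    by (simp add: y_def snd_sum sum_fun_apply scaleR_fun_def sum_divide_distrib)
  have layer: "\<bar>(\<Sum>k<N. of_bool (s k < z i t)) / real N - z i t\<bar> \<le> 1 / real N" if "i \<in> {1..n}" for i t
    unfolding s_def using unit_monotone_bounds[OF z(1)[OF that]] \<open>0 < N\<close> by (intro layer_cake_approx)
  have \<tau>_close: "\<bar>fst (y - x) i\<bar> \<le> T / real N" if i: "i \<in> {1..n}" for i
  proof -
    have zm[measurable]: "z i \<in> borel_measurable borel" by (rule unit_monotone_measurable[OF z(1)[OF i]])
    have int: "integrable (leb T) (\<lambda>t. of_bool (z i t \<le> s k) :: real)" for k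
    proof (rule integrable_leb_AE_bounded[of _ _ 1])
      show "(\<lambda>t. of_bool (z i t \<le> s k) :: real) \<in> borel_measurable (leb T)"
        by (intro borel_measurable_leb) measurable
    qed auto
    have int': "integrable (leb T) (\<lambda>t. 1 - z i t)"
      using unit_monotone_integrable[OF z(1)[OF i]]
      by (intro Bochner_Integration.integrable_diff)
        (simp_all add: finite_measure.integrable_const finite_measure_leb)
    have "fst (y - x) i = (\<Sum>k<N. LINT t|leb T. of_bool (z i t \<le> s k)) / real N - (LINT t|leb T. 1 - z i t)"
      using i by (simp add: fst_y x_eq z(4)[OF i] \<sigma>_def switch_eq_integral[OF z(1)[OF i]])
    \<comment> \<open>With crossing points written as integrals, the average over levels moves under
      the integral over \<open>t\<close>, and a pointwise rounding error remains.\<close>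
    also have "\<dots> = (LINT t|leb T. (\<Sum>k<N. of_bool (z i t \<le> s k)) / real N - (1 - z i t))"
      using int int' by (simp add: Bochner_Integration.integral_sum del: sum_of_bool_eq)
    finally have eq: "fst (y - x) i = (LINT t|leb T. (\<Sum>k<N. of_bool (z i t \<le> s k)) / real N - (1 - z i t))" .
    have b: "\<bar>(\<Sum>k<N. of_bool (z i t \<le> s k)) / real N - (1 - z i t)\<bar> \<le> 1 / real N" for t
    proof -
      have "of_bool (z i t \<le> s k) = 1 - (of_bool (s k < z i t) :: real)" for k by auto
      then have "(\<Sum>k<N. of_bool (z i t \<le> s k)) / real N - (1 - z i t)
          = - ((\<Sum>k<N. of_bool (s k < z i t)) / real N - z i t)"
        using \<open>0 < N\<close> by (simp add: sum_subtractf diff_divide_distrib del: of_bool_eq_1_iff of_bool_eq_0_iff)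
      then show ?thesis using layer[OF i, of t] by simp
    qed
    have "\<bar>fst (y - x) i\<bar> \<le> (LINT t|leb T. \<bar>(\<Sum>k<N. of_bool (z i t \<le> s k)) / real N - (1 - z i t)\<bar>)"
      unfolding eq by (rule integral_abs_bound)
    also have "\<dots> \<le> (LINT t|leb T. 1 / real N)"
    proof (rule integral_mono[OF Bochner_Integration.integrable_abs])
      show "integrable (leb T) (\<lambda>t. (\<Sum>k<N. of_bool (z i t \<le> s k)) / real N - (1 - z i t))"
        by (intro Bochner_Integration.integrable_diff[OF _ int'] integrable_divide
            Bochner_Integration.integrable_sum int)
    qed (simp add: finite_measure.integrable_const finite_measure_leb, rule b)
    also have "\<dots> = T / real N"
      using measure_leb[of T] \<open>0 < T\<close> by simp
    finally show ?thesis .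
  qed
  have c_close: "Lq_norm T q (snd (y - x) i) \<le> 2 / real N * T powr (1 / q)" if i: "i \<in> {1..n-1}" for i
  proof (rule Lq_norm_AE_le)
    have ii: "i \<in> {1..n}" "i + 1 \<in> {1..n}" using i by auto
    have d_eq: "d k i = indicat_real {switch T (z i) (s k)..<switch T (z (i + 1)) (s k)}" for k
      using i ii by (simp add: d_def \<sigma>_def)
    have eq: "snd (y - x) i = (\<lambda>t. (\<Sum>k<N. d k i t) / real N - c i t)"
      by (simp add: x_eq snd_y fun_eq_iff)
    have "(\<lambda>t. (\<Sum>k<N. d k i t) / real N) \<in> borel_measurable borel"
      unfolding d_eq by measurable
    then show "snd (y - x) i \<in> borel_measurable (leb T)"
      unfolding eq by (intro borel_measurable_diff borel_measurable_leb Lq_vec_measurable[OF tc(2) i])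
    have "AE t in leb T. \<forall>k. d k i t = of_bool (s k < z i t) - of_bool (s k < z (i + 1) t)"
      unfolding d_eq by (subst AE_all_countable) (intro allI AE_indicator_switch z ii i)
    then show "AE t in leb T. \<bar>snd (y - x) i t\<bar> \<le> 2 / real N"
      using z(2)[OF i]
    proof eventually_elim
      case (elim t)
      \<comment> \<open>One rounding error for each of the two functions whose difference is
        \<open>c i\<close>; hence the factor 2.\<close>
      have "(\<Sum>k<N. d k i t) / real N - c i t =
          ((\<Sum>k<N. of_bool (s k < z i t)) / real N - z i t) -
          ((\<Sum>k<N. of_bool (s k < z (i + 1) t)) / real N - z (i + 1) t)"
        using elim by (simp add: sum_subtractf diff_divide_distrib)
      then show ?case
        using layer[OF ii(1), of t] layer[OF ii(2), of t] unfolding eq by (simp add: abs_le_iff field_simps)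
    qed
  qed (use \<open>0 < T\<close> \<open>0 < q\<close> in auto)
  have "RL_norm T q n (y - x) \<le> (\<Sum>i=1..n. \<bar>fst (y - x) i\<bar>) + (\<Sum>i=1..n-1. Lq_norm T q (snd (y - x) i))"
    unfolding RL_norm_def by (intro add_right_mono L2_set_le_sum_abs)
  also have "\<dots> \<le> (\<Sum>i=1..n. T / real N) + (\<Sum>i=1..n-1. 2 / real N * T powr (1 / q))"
    by (intro add_mono sum_mono \<tau>_close c_close)
  also have "\<dots> = (real n * T + real (n - 1) * (2 * T powr (1 / q))) / real N"
    by (simp add: add_divide_distrib)
  finally have "RL_norm T q n (y - x) \<le> (real n * T + real (n - 1) * (2 * T powr (1 / q))) / real N" .
  with y_hull show thesis by (rule that)
qed

lemma convex_hull_feasible_subset: "0 \<le> q \<Longrightarrow> convex hull (feasible T q n) \<subseteq> relaxed T q n"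
  by (intro hull_minimal feasible_subset_relaxed convex_relaxed)

section \<open>Identification of the closure\<close>

lemma relaxed_eq_closure:
  assumes "0 < T" "0 < q"
  shows "relaxed T q n = RL_topology T q n closure_of (convex hull (feasible T q n))"
proof
  show "RL_topology T q n closure_of (convex hull (feasible T q n)) \<subseteq> relaxed T q n"
    using assms by (intro closure_of_minimal convex_hull_feasible_subset closedin_relaxed) auto
  show "relaxed T q n \<subseteq> RL_topology T q n closure_of (convex hull (feasible T q n))"
  proof
    fix x assume x: "x \<in> relaxed T q n"
    show "x \<in> RL_topology T q n closure_of (convex hull (feasible T q n))"
      unfolding in_closure_of topspace_RL_topology openin_RL_topology
    proof (intro conjI allI impI)
      show "x \<in> RL_space T q n" using x relaxed_subset by blast
      fix U assume "x \<in> U \<and> RL_open T q n U"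
      then obtain e where e: "e > 0" "\<And>y. y \<in> RL_space T q n \<Longrightarrow> RL_norm T q n (y - x) < e \<Longrightarrow> y \<in> U"
        unfolding RL_open_def by blast
      define C where "C = real n * T + real (n - 1) * (2 * T powr (1 / q))"
      \<comment> \<open>The maximum with 0 forces \<open>N\<close> to be positive, as the
        approximation requires.\<close>
      obtain N where N: "C / e < real N" "0 < N"
        using reals_Archimedean2[of "max (C / e) 0"] by auto
      obtain y where y: "y \<in> convex hull (feasible T q n)" "RL_norm T q n (y - x) \<le> C / real N"
        using relaxed_approximation[OF x assms N(2)] unfolding C_def by blast
      have "C / real N < e"
        using N e(1) by (simp add: field_simps)
      moreover have "y \<in> RL_space T q n"
        using y(1) convex_hull_feasible_subset[of q T n] relaxed_subset[of T q n] assms by auto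
      ultimately have "y \<in> U" using y(2) by (intro e(2)) auto
      with y(1) show "\<exists>y. y \<in> convex hull (feasible T q n) \<and> y \<in> U" by blast
    qed
  qed
qed

theorem theorem6p3:
  fixes T q :: real and n :: nat
  assumes "T > 0" and "q > 1" and "n \<ge> 2"
  shows "{(\<tau>, c). (\<tau>, c) \<in> Rvec n \<times> Lq_vec T q (n - 1) \<and>
            (\<exists>z\<in>Lq_vec T q n. (\<tau>, c, z) \<in> feasible_ext T q n)}
         = RL_topology T q n closure_of (convex hull (feasible T q n))"
proof -
  have "{(\<tau>, c). (\<tau>, c) \<in> Rvec n \<times> Lq_vec T q (n - 1) \<and>
            (\<exists>z\<in>Lq_vec T q n. (\<tau>, c, z) \<in> feasible_ext T q n)} = relaxed T q n" (is "?L = _")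
  proof
    show "?L \<subseteq> relaxed T q n" using feasible_ext_imp_relaxed by blast
    show "relaxed T q n \<subseteq> ?L"
    proof
      fix x assume "x \<in> relaxed T q n"
      moreover obtain \<tau> c where "x = (\<tau>, c)" by (cases x)
      ultimately have x: "x = (\<tau>, c)" "(\<tau>, c) \<in> relaxed T q n" by simp_all
      then obtain z where "z \<in> Lq_vec T q n" "(\<tau>, c, z) \<in> feasible_ext T q n"
        using relaxed_imp_feasible_ext[of \<tau> c T q n] assms by auto
      then show "x \<in> ?L" using x relaxed_subset[of T q n] by (auto simp: RL_space_def)
    qed
  qed
  then show ?thesis
    using relaxed_eq_closure[of T q n] assms by simp
qed

end
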